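(* Suppose that $M$ is RDD, that we can sample from the distribution $|t|/\|t\|_1$ in $O(1)$ time, and that $\|t\|_1$ is known. Then there exists a randomized algorithm that computes an estimate $\hat x$ such that $\Pr\{|\hat x-t^{\top}x^{\ast}|\le\varepsilon\|D_M^{-1}b\|_\infty\}\ge\frac34$ in time $O(f_{\mathrm{row}}(M)\|t\|_1^2L^3\varepsilon^{-2})$, i.e. $\widetilde O(f_{\mathrm{row}}(M)\|t\|_1^2\gamma^{-3}\varepsilon^{-2})$.
   Context: Setting: $M\in\mathbb{R}^{n\times n}$, $b\in\operatorname{range}(M)$, $t\in\mathbb{R}^n$, $b,t\ne0$, with all nonzero entries of $M,b,t$ having absolute value in $[1/\mathrm{poly}(n),\mathrm{poly}(n)]$. $M$ is RDD if its diagonal is positive and $M(j,j)\ge\sum_{k\ne j}|M(j,k)|$ for all $j$. Write $M=D_M-A_M^{\top}$ with $D_M$ the diagonal part of $M$ and $A_M^{\top}$ with zero diagonal; $x^{\ast}:=\frac12\sum_{\ell\ge0}(\frac12(I+D_M^{-1}A_M^{\top}))^{\ell}D_M^{-1}b$ (a solution of $Mx=b$). Access: diagonal entries of $M$ in $O(1)$ time; nonzero entries of any row/column of $M$ in time linear in their number; entries of $b,t$ in $O(1)$ time. The algorithm is given $n$, $\varepsilon>0$ and $\gamma$ with $0<\gamma\le\gamma_{\max}(M)$, where $\gamma_{\max}(M)=\max_{p\in[1,\infty]}\big(1-\|\frac12(I+D_M^{-1/q}A_M^{\top}D_M^{-1/p})|_{\operatorname{range}(I-D_M^{-1/q}A_M^{\top}D_M^{-1/p})}\|_p\big)$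 ($q$ conjugate to $p$, restriction norm = max over unit vectors of the subspace). The truncation parameter is $L=\Theta\big(\frac1\gamma\log(\frac{1}{\gamma E}d_{\max}(M)\|t\|_0\|D_M^{-1}t\|_\infty\|b\|_0\|D_M^{-1}b\|_\infty)\big)$, where $E$ is the target accuracy (here $\varepsilon\|D_M^{-1}b\|_\infty$), $d_{\max}(M)$ the largest diagonal entry, and suitable upper bounds on the quantities inside the logarithm are assumed known. $f_{\mathrm{row}}(M)$ is the maximum time to simulate one step of the (possibly terminating) random walk with row-substochastic transition matrix $\frac12(I+D_M^{-1}|A_M^{\top}|)$. $\widetilde O$ hides polylogarithmic factors.
   Formalization: Simulating one walk step in time f_row(M) is taken to report also the sign of the traversed entry of A_M^T, without which the claim fails for dense M; the logarithm in L is cut off below at 1 and O(X) is read as O(max(1,X)), since for large ε they would fall below constant time. *)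

theory Defs
  imports
    "HOL-Probability.Probability"
    "HOL-Probability.SPMF"
    "Jordan_Normal_Form.Matrix"
begin

unbundle no vec_syntax
unbundle no inner_syntax

text \<open>\<open>D_pow M r\<close> is the real power \<open>D\<^sub>M\<^sup>r\<close> of the diagonal part of \<open>M\<close>
  (meaningful for a positive diagonal), and \<open>AT M\<close> is \<open>A\<^sub>M\<^sup>T = D\<^sub>M - M\<close>.\<close>

definition D_mat :: "real mat \<Rightarrow> real mat" where
  "D_mat M = mat_diag (dim_row M) (\<lambda>i. M $$ (i, i))"

definition D_pow :: "real mat \<Rightarrow> real \<Rightarrow> real mat" where
  "D_pow M r = mat_diag (dim_row M) (\<lambda>i. M $$ (i, i) powr r)"

definition AT :: "real mat \<Rightarrow> real mat" where
  "AT M = D_mat M - M"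

definition RDD :: "real mat \<Rightarrow> bool" where
  "RDD M \<longleftrightarrow> (\<forall>j<dim_row M. 0 < M $$ (j, j) \<and>
     (\<Sum>k\<in>{..<dim_col M} - {j}. \<bar>M $$ (j, k)\<bar>) \<le> M $$ (j, j))"

definition mat_range :: "real mat \<Rightarrow> real Matrix.vec set" where
  "mat_range M = (\<lambda>x. M *\<^sub>v x) ` carrier_vec (dim_col M)"

definition d_max :: "real mat \<Rightarrow> real" where
  "d_max M = Max ((\<lambda>i. M $$ (i, i)) ` {..<dim_row M})"

definition lp_norm :: "ereal \<Rightarrow> real Matrix.vec \<Rightarrow> real" where
  "lp_norm p v =
     (if p = \<infinity> then Max ((\<lambda>i. \<bar>v $ i\<bar>) ` {..<dim_vec v})
      else (\<Sum>i<dim_vec v. \<bar>v $ i\<bar> powr real_of_ereal p) powr (1 / real_of_ereal p))"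

definition l0_norm :: "real Matrix.vec \<Rightarrow> nat" where
  "l0_norm v = card {i. i < dim_vec v \<and> v $ i \<noteq> 0}"

definition restr_norm :: "ereal \<Rightarrow> real mat \<Rightarrow> real Matrix.vec set \<Rightarrow> real" where
  "restr_norm p B S = Sup {lp_norm p (B *\<^sub>v v) | v. v \<in> S \<and> lp_norm p v = 1}"

text \<open>\<open>scaled_AT M p\<close> is \<open>D\<^sup>-\<^sup>1\<^sup>/\<^sup>q A\<^sup>T D\<^sup>-\<^sup>1\<^sup>/\<^sup>p\<close> with \<open>1/q = 1 - 1/p\<close>; in type \<open>ereal\<close> one has \<open>1/\<infinity> = 0\<close>.\<close>

definition scaled_AT :: "real mat \<Rightarrow> ereal \<Rightarrow> real mat" where
  "scaled_AT M p =
     (let r = real_of_ereal (1 / p) in D_pow M (- (1 - r)) * AT M * D_pow M (- r))"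

text \<open>The supremum over the compact range of \<open>p\<close> is attained, as the restricted norm is continuous
  in \<open>1/p \<in> [0, 1]\<close>.\<close>

definition gamma_max :: "real mat \<Rightarrow> real" where
  "gamma_max M =
     (SUP p\<in>{1..\<infinity>}.
        1 - restr_norm p ((1/2) \<cdot>\<^sub>m (1\<^sub>m (dim_row M) + scaled_AT M p))
              (mat_range (1\<^sub>m (dim_row M) - scaled_AT M p)))"

definition x_star :: "real mat \<Rightarrow> real Matrix.vec \<Rightarrow> real Matrix.vec" where
  "x_star M b =
     (let W = (1/2) \<cdot>\<^sub>m (1\<^sub>m (dim_row M) + D_pow M (-1) * AT M)
      in Matrix.vec (dim_row M)
           (\<lambda>i. 1/2 * (\<Sum>l. ((W ^\<^sub>m l) *\<^sub>v (D_pow M (-1) *\<^sub>v b)) $ i)))"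

text \<open>The polynomials bounding the magnitudes are normalised to \<open>K n\<^sup>K\<close>, which dominates every
  polynomial in \<open>n \<ge> 1\<close> for large \<open>K\<close>.\<close>

definition poly_magnitude :: "nat \<Rightarrow> nat \<Rightarrow> real \<Rightarrow> bool" where
  "poly_magnitude K n x \<longleftrightarrow>
     x = 0 \<or> (1 / (real K * real n ^ K) \<le> \<bar>x\<bar> \<and> \<bar>x\<bar> \<le> real K * real n ^ K)"

text \<open>The argument of the logarithm in the truncation parameter, for target accuracy \<open>E\<close>.\<close>

definition log_arg :: "real mat \<Rightarrow> real Matrix.vec \<Rightarrow> real Matrix.vec \<Rightarrow> real \<Rightarrow> real \<Rightarrow> real" where
  "log_arg M b t \<gamma> E =
     1 / (\<gamma> * E) * d_max M * real (l0_norm t) * lp_norm \<infinity> (D_pow M (-1) *\<^sub>v t)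
       * real (l0_norm b) * lp_norm \<infinity> (D_pow M (-1) *\<^sub>v b)"

text \<open>The logarithm is cut off below at 1, as a truncation length has to be positive even when
  the accuracy \<open>E\<close> is so large that the logarithm is not.\<close>

definition trunc_L :: "real mat \<Rightarrow> real Matrix.vec \<Rightarrow> real Matrix.vec \<Rightarrow> real \<Rightarrow> real \<Rightarrow> real" where
  "trunc_L M b t \<gamma> E = 1 / \<gamma> * max 1 (ln (log_arg M b t \<gamma> E))"

definition walk_matrix :: "real mat \<Rightarrow> real mat" where
  "walk_matrix M = (1/2) \<cdot>\<^sub>m (1\<^sub>m (dim_row M) + D_pow M (-1) * map_mat abs (AT M))"

text \<open>The missing mass of a row is the probability that the walk terminates (outcome \<open>None\<close>).\<close>

definition walk_step :: "real mat \<Rightarrow> nat \<Rightarrow> nat option pmf" where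
  "walk_step M i =
     embed_spmf (\<lambda>j. if i < dim_row M \<and> j < dim_row M then walk_matrix M $$ (i, j) else 0)"

text \<open>The sign of the traversed entry of \<open>(I + D\<^sup>-\<^sup>1 A\<^sup>T) / 2\<close>.\<close>

definition walk_sign :: "real mat \<Rightarrow> nat \<Rightarrow> nat \<Rightarrow> real" where
  "walk_sign M i j = (if i = j then 1 else sgn (AT M $$ (i, j)))"

definition target_pmf :: "real Matrix.vec \<Rightarrow> nat pmf" where
  "target_pmf t = embed_pmf (\<lambda>i. if i < dim_vec t then \<bar>t $ i\<bar> / lp_norm 1 t else 0)"

definition f_row :: "nat \<Rightarrow> (nat \<Rightarrow> nat) \<Rightarrow> nat" where
  "f_row n \<tau> = Max (\<tau> ` {..<n})"

text \<open>A real RAM with a memory of natural numbers (used for indices and addresses), a memory of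
  real numbers, and a clock. Programs are finite and independent of the input, their constants
  are rational, and every instruction and every evaluation of a test takes one time unit unless
  stated otherwise. There is no rounding from reals to integers.\<close>

record machine =
  nmem :: "nat \<Rightarrow> nat"
  rmem :: "nat \<Rightarrow> real"
  clock :: nat

datatype instr =
    NConst nat nat
  | NAdd nat nat nat
  | NSub nat nat nat
  | NLoad nat nat
  | NStore nat nat
  | RConst nat rat
  | RAdd nat nat nat
  | RSub nat nat nat
  | RMul nat nat nat
  | RDiv nat nat nat
  | RLn nat nat
  | RLoad nat nat
  | RStore nat nat
  | ROfNat nat nat
  | Coin nat
  | GetDiag nat nat
  | GetRow nat nat
  | GetCol nat nat
  | GetB nat nat
  | GetT nat nat
  | SampleT nat
  | WalkStep nat nat nat

datatype test = NLess nat nat | RLess nat nat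

datatype prog =
    Skip
  | Do instr
  | Seq prog prog
  | If test prog prog
  | While test prog

definition tick :: "nat \<Rightarrow> machine \<Rightarrow> machine" where
  "tick c s = s\<lparr>clock := clock s + c\<rparr>"

definition setN :: "nat \<Rightarrow> nat \<Rightarrow> machine \<Rightarrow> machine" where
  "setN a x s = s\<lparr>nmem := (nmem s)(a := x)\<rparr>"

definition setR :: "nat \<Rightarrow> real \<Rightarrow> machine \<Rightarrow> machine" where
  "setR a x s = s\<lparr>rmem := (rmem s)(a := x)\<rparr>"

text \<open>Writing a sparse vector, given by the list of the positions of its nonzero entries and the
  entry function, at address \<open>p\<close>: the number of nonzero entries goes to cell \<open>p\<close> of the natural-number
  memory, and positions and values go to the cells from \<open>p + 1\<close> on of the two memories.\<close>

definition write_sparse :: "nat \<Rightarrow> nat list \<Rightarrow> (nat \<Rightarrow> real) \<Rightarrow> machine \<Rightarrow> machine" where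
  "write_sparse p js f s = s
     \<lparr>nmem := (\<lambda>x. if x = p then length js
                   else if p < x \<and> x \<le> p + length js then js ! (x - p - 1) else nmem s x),
      rmem := (\<lambda>x. if p < x \<and> x \<le> p + length js then f (js ! (x - p - 1)) else rmem s x)\<rparr>"

definition row_support :: "real mat \<Rightarrow> nat \<Rightarrow> nat list" where
  "row_support M i = filter (\<lambda>j. i < dim_row M \<and> M $$ (i, j) \<noteq> 0) [0..<dim_col M]"

definition col_support :: "real mat \<Rightarrow> nat \<Rightarrow> nat list" where
  "col_support M j = filter (\<lambda>i. j < dim_col M \<and> M $$ (i, j) \<noteq> 0) [0..<dim_row M]"

text \<open>The input consists of \<open>M\<close>, \<open>b\<close>, \<open>t\<close>; \<open>\<tau> i\<close> is the (maximum) time taken to simulate one step of the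
  random walk from state \<open>i\<close>. Reading a row or column takes time linear in its number of
  nonzero entries. \<open>WalkStep a c d\<close> simulates one step from the state in natural-number cell \<open>d\<close>: it puts the new
  state into natural-number cell \<open>a\<close> and the sign of the traversed entry into real cell \<open>c\<close>; termination of the
  walk is signalled by sign 0. Accesses outside of the index range return 0.\<close>

fun exec_instr ::
  "real mat \<Rightarrow> real Matrix.vec \<Rightarrow> real Matrix.vec \<Rightarrow> (nat \<Rightarrow> nat) \<Rightarrow> instr \<Rightarrow> machine \<Rightarrow> machine spmf"
where
  "exec_instr M b t \<tau> (NConst a k) s = return_spmf (tick 1 (setN a k s))"
| "exec_instr M b t \<tau> (NAdd a c d) s = return_spmf (tick 1 (setN a (nmem s c + nmem s d) s))"
| "exec_instr M b t \<tau> (NSub a c d) s = return_spmf (tick 1 (setN a (nmem s c - nmem s d) s))"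
| "exec_instr M b t \<tau> (NLoad a c) s = return_spmf (tick 1 (setN a (nmem s (nmem s c)) s))"
| "exec_instr M b t \<tau> (NStore a c) s = return_spmf (tick 1 (setN (nmem s a) (nmem s c) s))"
| "exec_instr M b t \<tau> (RConst a x) s = return_spmf (tick 1 (setR a (real_of_rat x) s))"
| "exec_instr M b t \<tau> (RAdd a c d) s = return_spmf (tick 1 (setR a (rmem s c + rmem s d) s))"
| "exec_instr M b t \<tau> (RSub a c d) s = return_spmf (tick 1 (setR a (rmem s c - rmem s d) s))"
| "exec_instr M b t \<tau> (RMul a c d) s = return_spmf (tick 1 (setR a (rmem s c * rmem s d) s))"
| "exec_instr M b t \<tau> (RDiv a c d) s = return_spmf (tick 1 (setR a (rmem s c / rmem s d) s))"
| "exec_instr M b t \<tau> (RLn a c) s = return_spmf (tick 1 (setR a (ln (rmem s c)) s))"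
| "exec_instr M b t \<tau> (RLoad a c) s = return_spmf (tick 1 (setR a (rmem s (nmem s c)) s))"
| "exec_instr M b t \<tau> (RStore a c) s = return_spmf (tick 1 (setR (nmem s a) (rmem s c) s))"
| "exec_instr M b t \<tau> (ROfNat a c) s = return_spmf (tick 1 (setR a (real (nmem s c)) s))"
| "exec_instr M b t \<tau> (Coin a) s =
     map_spmf (\<lambda>h. tick 1 (setN a (of_bool h) s)) coin_spmf"
| "exec_instr M b t \<tau> (GetDiag a c) s =
     (let i = nmem s c
      in return_spmf (tick 1 (setR a (if i < dim_row M then M $$ (i, i) else 0) s)))"
| "exec_instr M b t \<tau> (GetRow a c) s =
     (let i = nmem s c; js = row_support M i
      in return_spmf (tick (1 + length js) (write_sparse (nmem s a) js (\<lambda>j. M $$ (i, j)) s)))"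
| "exec_instr M b t \<tau> (GetCol a c) s =
     (let j = nmem s c; js = col_support M j
      in return_spmf (tick (1 + length js) (write_sparse (nmem s a) js (\<lambda>i. M $$ (i, j)) s)))"
| "exec_instr M b t \<tau> (GetB a c) s =
     (let i = nmem s c in return_spmf (tick 1 (setR a (if i < dim_vec b then b $ i else 0) s)))"
| "exec_instr M b t \<tau> (GetT a c) s =
     (let i = nmem s c in return_spmf (tick 1 (setR a (if i < dim_vec t then t $ i else 0) s)))"
| "exec_instr M b t \<tau> (SampleT a) s =
     map_spmf (\<lambda>i. tick 1 (setN a i s)) (spmf_of_pmf (target_pmf t))"
| "exec_instr M b t \<tau> (WalkStep a c d) s =
     (let i = nmem s d
      in map_spmf
           (\<lambda>r. tick (max 1 (\<tau> i))
                  (case r of None \<Rightarrow> setR c 0 s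
                   | Some j \<Rightarrow> setN a j (setR c (walk_sign M i j) s)))
           (spmf_of_pmf (walk_step M i)))"

fun holds :: "test \<Rightarrow> machine \<Rightarrow> bool" where
  "holds (NLess a c) s \<longleftrightarrow> nmem s a < nmem s c"
| "holds (RLess a c) s \<longleftrightarrow> rmem s a < rmem s c"

partial_function (spmf) while_spmf ::
  "('s \<Rightarrow> bool) \<Rightarrow> ('s \<Rightarrow> 's spmf) \<Rightarrow> 's \<Rightarrow> 's spmf" where
  "while_spmf g body s =
     (if g s then bind_spmf (body s) (while_spmf g body) else return_spmf s)"

text \<open>The missing mass of the resulting subdistribution is the probability of divergence.\<close>

primrec exec ::
  "real mat \<Rightarrow> real Matrix.vec \<Rightarrow> real Matrix.vec \<Rightarrow> (nat \<Rightarrow> nat) \<Rightarrow> prog \<Rightarrow> machine \<Rightarrow> machine spmf"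
where
  "exec M b t \<tau> Skip = return_spmf"
| "exec M b t \<tau> (Do i) = exec_instr M b t \<tau> i"
| "exec M b t \<tau> (Seq P Q) = (\<lambda>s. bind_spmf (exec M b t \<tau> P s) (exec M b t \<tau> Q))"
| "exec M b t \<tau> (If c P Q) =
     (\<lambda>s. if holds c s then exec M b t \<tau> P (tick 1 s) else exec M b t \<tau> Q (tick 1 s))"
| "exec M b t \<tau> (While c P) =
     (\<lambda>s. map_spmf (tick 1) (while_spmf (holds c) (\<lambda>s. exec M b t \<tau> P (tick 1 s)) s))"

text \<open>The parameters given to the algorithm are \<open>n\<close>, \<open>\<epsilon>\<close>, \<open>\<gamma>\<close>, the norm \<open>\<parallel>t\<parallel>\<^sub>1\<close> and an upper bound
  \<open>U\<close> on the argument of the logarithm in the truncation parameter. The estimate is left in real cell 0.\<close>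

definition initial :: "nat \<Rightarrow> real \<Rightarrow> real \<Rightarrow> real \<Rightarrow> real \<Rightarrow> machine" where
  "initial n \<epsilon> \<gamma> t1 U =
     \<lparr>nmem = (\<lambda>_. 0)(0 := n),
      rmem = (\<lambda>_. 0)(0 := \<epsilon>, 1 := \<gamma>, 2 := t1, 3 := U),
      clock = 0\<rparr>"

definition estimate :: "machine \<Rightarrow> real" where
  "estimate s = rmem s 0"

definition run ::
  "prog \<Rightarrow> real mat \<Rightarrow> real Matrix.vec \<Rightarrow> real Matrix.vec \<Rightarrow> (nat \<Rightarrow> nat)
     \<Rightarrow> real \<Rightarrow> real \<Rightarrow> real \<Rightarrow> machine spmf" where
  "run P M b t \<tau> \<epsilon> \<gamma> U = exec M b t \<tau> P (initial (dim_row M) \<epsilon> \<gamma> (lp_norm 1 t) U)"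

end

theory Submission
  imports Defs
begin

text \<open>Write \<open>W = (I + D\<^sup>-\<^sup>1 A\<^sup>T) / 2\<close>. The estimator draws \<open>i\<close> from \<open>|t| / \<parallel>t\<parallel>\<^sub>1\<close> and follows the
  random walk from \<open>i\<close> for \<open>m\<close> steps, adding up the signed values of \<open>D\<^sup>-\<^sup>1 b\<close>; the mean of this sum is
  \<open>t\<^sup>T (\<Sum>l<m. W\<^sup>l D\<^sup>-\<^sup>1 b) / \<parallel>t\<parallel>\<^sub>1\<close>, and as \<open>W\<close> is a contraction for the maximum norm, the sum is
  bounded by \<open>m \<parallel>D\<^sup>-\<^sup>1 b\<parallel>\<^sub>\<infinity>\<close>. By Chebyshev's inequality \<open>(2 \<parallel>t\<parallel>\<^sub>1 m / \<epsilon>)\<^sup>2\<close> independent walks are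
  accurate to half of the target accuracy with probability \<open>3/4\<close>. The other half covers the truncation at \<open>m\<close>: conjugation
  by \<open>D\<^sup>1\<^sup>/\<^sup>p\<close> turns \<open>W\<close> into \<open>(I + S) / 2\<close> with \<open>S = D\<^sup>-\<^sup>1\<^sup>/\<^sup>q A\<^sup>T D\<^sup>-\<^sup>1\<^sup>/\<^sup>p\<close>, which leaves
  the range of \<open>I - S\<close> invariant and contracts its \<open>p\<close>-norm, and \<open>D\<^sup>-\<^sup>1\<^sup>/\<^sup>q b\<close> lies in this range.

  If \<open>\<parallel>t\<parallel>\<^sub>1 m \<le> \<epsilon>\<close> the answer 0 is accurate enough, which is what keeps the running time bounded
  by a constant when the bound of the theorem is small.\<close>

section \<open>The truncated series\<close>

lemma ereal_ge_1_cases: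
  assumes "1 \<le> (p :: ereal)"
  obtains "p = \<infinity>" | r where "p = ereal r" "1 \<le> r"
  using assms by (cases p) (auto simp: one_ereal_def)

lemma abs_le_lp_norm:
  assumes "1 \<le> p" "i < dim_vec v"
  shows "\<bar>v $ i\<bar> \<le> lp_norm p v"
  using assms(1)
proof (cases rule: ereal_ge_1_cases)
  case 1
  then show ?thesis using assms(2) by (auto simp: lp_norm_def intro!: Max_ge)
next
  case (2 r)
  have "\<bar>v $ i\<bar> = (\<bar>v $ i\<bar> powr r) powr (1 / r)"
    using 2 by (simp add: powr_powr)
  also have "\<dots> \<le> (\<Sum>i<dim_vec v. \<bar>v $ i\<bar> powr r) powr (1 / r)"
    using 2 assms(2) by (intro powr_mono2 member_le_sum) auto
  finally show ?thesis using 2 by (simp add: lp_norm_def)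
qed

text \<open>For a finite exponent \<open>r\<close> only \<open>l0_norm v\<close> summands are
  nonzero, and \<open>l0_norm v powr (1 / r)\<close> is at most \<open>l0_norm v\<close>. Giving up
  the root makes the bound uniform in \<open>p\<close>.\<close>

lemma lp_norm_le:
  assumes "1 \<le> p" "0 < dim_vec v" "\<And>i. i < dim_vec v \<Longrightarrow> \<bar>v $ i\<bar> \<le> c"
  shows "lp_norm p v \<le> real (l0_norm v) * c"
  using assms(1)
proof (cases rule: ereal_ge_1_cases)
  case 1
  have "\<bar>v $ i\<bar> \<le> real (l0_norm v) * c" if i: "i < dim_vec v" for i
  proof (cases "v $ i = 0")
    case True
    then show ?thesis using assms(3)[OF i] by simp
  next
    case False
    then have "0 < l0_norm v" unfolding l0_norm_def using i by (auto simp: card_gt_0_iff)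
    then have "1 * c \<le> real (l0_norm v) * c"
      using assms(3)[OF i] by (intro mult_right_mono) auto
    with assms(3)[OF i] show ?thesis by simp
  qed
  moreover have "Max ((\<lambda>i. \<bar>v $ i\<bar>) ` {..<dim_vec v}) \<in> (\<lambda>i. \<bar>v $ i\<bar>) ` {..<dim_vec v}"
    using assms(2) by (intro Max_in) auto
  ultimately show ?thesis using 1 by (auto simp: lp_norm_def)
next
  case (2 r)
  have c: "0 \<le> c" using assms(3)[OF assms(2)] by linarith
  have "(\<Sum>i<dim_vec v. \<bar>v $ i\<bar> powr r) = (\<Sum>i | i < dim_vec v \<and> v $ i \<noteq> 0. \<bar>v $ i\<bar> powr r)"
    by (intro sum.mono_neutral_right) auto
  also have "\<dots> \<le> (\<Sum>i | i < dim_vec v \<and> v $ i \<noteq> 0. c powr r)"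
    using assms(3) 2 by (intro sum_mono powr_mono2) auto
  also have "\<dots> = real (l0_norm v) * c powr r" by (simp add: l0_norm_def)
  finally have "lp_norm p v \<le> (real (l0_norm v) * c powr r) powr (1 / r)"
    using 2 by (auto simp: lp_norm_def intro!: powr_mono2 sum_nonneg)
  also have "\<dots> = real (l0_norm v) powr (1 / r) * c"
    using 2 c by (simp add: powr_mult powr_powr)
  also have "\<dots> \<le> real (l0_norm v) * c"
  proof (cases "l0_norm v = 0")
    case False
    then have "real (l0_norm v) powr (1 / r) \<le> real (l0_norm v) powr 1"
      using 2 by (intro powr_mono) auto
    then show ?thesis using c by (intro mult_right_mono) auto
  qed simp
  finally show ?thesis .
qed

lemma lp_norm_smult:
  assumes "1 \<le> p" "0 < dim_vec v"
  shows "lp_norm p (k \<cdot>\<^sub>v v) = \<bar>k\<bar> * lp_norm p v"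
  using assms(1)
proof (cases rule: ereal_ge_1_cases)
  case 1
  have "Max ((\<lambda>x. \<bar>k\<bar> * x) ` ((\<lambda>i. \<bar>v $ i\<bar>) ` {..<dim_vec v}))
      = \<bar>k\<bar> * Max ((\<lambda>i. \<bar>v $ i\<bar>) ` {..<dim_vec v})"
    using assms(2) by (intro mono_Max_commute[symmetric]) (auto intro!: monoI mult_left_mono)
  then show ?thesis using 1 by (simp add: lp_norm_def abs_mult image_image)
next
  case (2 r)
  have "(\<Sum>i<dim_vec v. \<bar>k * v $ i\<bar> powr r) = \<bar>k\<bar> powr r * (\<Sum>i<dim_vec v. \<bar>v $ i\<bar> powr r)"
    by (simp add: abs_mult powr_mult sum_distrib_left)
  then show ?thesis using 2
    by (simp add: lp_norm_def powr_mult powr_powr sum_nonneg)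
qed

text \<open>\<open>restr_norm\<close> is a \<open>Sup\<close> of reals and dominates its members
  only if they are bounded above, so boundedness comes first; homogeneity then extends the bound
  from unit vectors to all of \<open>S\<close>.\<close>

lemma restr_norm_bound:
  assumes p: "1 \<le> p" and B: "B \<in> carrier_mat n n" and n: "0 < n"
    and S: "S \<subseteq> carrier_vec n" "\<And>k v. v \<in> S \<Longrightarrow> k \<cdot>\<^sub>v v \<in> S" and v: "v \<in> S"
  shows "lp_norm p (B *\<^sub>v v) \<le> restr_norm p B S * lp_norm p v"
proof -
  define X where "X = {lp_norm p (B *\<^sub>v v) | v. v \<in> S \<and> lp_norm p v = 1}"
  have bdd: "bdd_above X"
  proof (rule bdd_aboveI)
    fix x assume "x \<in> X"
    then obtain u where u: "u \<in> S" "lp_norm p u = 1" "x = lp_norm p (B *\<^sub>v u)"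
      by (auto simp: X_def)
    have ud: "u \<in> carrier_vec n" using u S by auto
    \<comment> \<open>The entries of a vector of p-norm 1 are at most 1 in absolute value, so this
      sum bounds every entry of the image. It is crude, but only finiteness matters.\<close>
    let ?c = "\<Sum>i<n. \<Sum>j<n. \<bar>B $$ (i, j)\<bar>"
    have "\<bar>(B *\<^sub>v u) $ i\<bar> \<le> ?c" if i: "i < n" for i
    proof -
      have "\<bar>(B *\<^sub>v u) $ i\<bar> \<le> (\<Sum>j<n. \<bar>B $$ (i, j)\<bar> * \<bar>u $ j\<bar>)"
        using i B ud by (auto simp: scalar_prod_def abs_mult[symmetric] atLeast0LessThan)
      also have "\<dots> \<le> (\<Sum>j<n. \<bar>B $$ (i, j)\<bar>)"
        using abs_le_lp_norm[OF p, of _ u] u(2) ud by (intro sum_mono mult_left_le) auto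
      also have "\<dots> \<le> ?c" using i by (intro member_le_sum[of i "{..<n}"]) (auto intro: sum_nonneg)
      finally show ?thesis .
    qed
    then have "x \<le> real (l0_norm (B *\<^sub>v u)) * ?c"
      unfolding u(3) using B n by (intro lp_norm_le p) auto
    also have "\<dots> \<le> real n * ?c"
    proof (intro mult_right_mono)
      have "l0_norm (B *\<^sub>v u) \<le> card {..<n}"
        unfolding l0_norm_def using B by (intro card_mono) auto
      then show "real (l0_norm (B *\<^sub>v u)) \<le> real n" by simp
    qed (auto intro!: sum_nonneg)
    finally show "x \<le> real n * ?c" .
  qed
  have vd: "v \<in> carrier_vec n" using S v by auto
  define c where "c = lp_norm p v"
  show ?thesis
  \<comment> \<open>A vector of norm 0 cannot be rescaled to a unit vector; it is zero, and so is
    its image.\<close>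
  proof (cases "c = 0")
    case True
    have "v = 0 \<cdot>\<^sub>v v"
      using abs_le_lp_norm[OF p, of _ v] True vd by (intro eq_vecI) (auto simp: c_def)
    then have "B *\<^sub>v v = 0 \<cdot>\<^sub>v (B *\<^sub>v v)"
      using B vd by (metis mult_mat_vec)
    then have "lp_norm p (B *\<^sub>v v) = 0"
      using lp_norm_smult[OF p, of "B *\<^sub>v v" 0] B n by simp
    then show ?thesis using True by (simp add: c_def)
  next
    case False
    then have c: "0 < c"
      using abs_le_lp_norm[OF p, of 0 v] n vd unfolding c_def by force
    have "lp_norm p ((1/c) \<cdot>\<^sub>v v) = 1"
      using lp_norm_smult[OF p, of v "1/c"] c vd n by (simp add: c_def)
    then have "lp_norm p (B *\<^sub>v ((1/c) \<cdot>\<^sub>v v)) \<in> X"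
      using S v by (auto simp: X_def)
    then have "lp_norm p (B *\<^sub>v ((1/c) \<cdot>\<^sub>v v)) \<le> restr_norm p B S"
      unfolding restr_norm_def X_def[symmetric] using bdd by (rule cSup_upper)
    moreover have "lp_norm p (B *\<^sub>v ((1/c) \<cdot>\<^sub>v v)) = lp_norm p (B *\<^sub>v v) / c"
      using lp_norm_smult[OF p, of "B *\<^sub>v v" "1/c"] c vd n B by (simp add: mult_mat_vec)
    ultimately show ?thesis using c by (simp add: c_def field_simps)
  qed
qed

text \<open>The matrix power unfolds with the new factor on the right, whereas the recursion of the
  iterates multiplies by \<open>W\<close> on the left.\<close>

lemma pow_mat_Suc_left:
  fixes A :: "'a :: semiring_1 mat"
  assumes "A \<in> carrier_mat n n"
  shows "A ^\<^sub>m Suc l = A * A ^\<^sub>m l"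
proof (induction l)
  case 0
  then show ?case using assms by simp
next
  case (Suc l)
  have "A ^\<^sub>m Suc (Suc l) = (A * A ^\<^sub>m l) * A" using Suc by simp
  also have "\<dots> = A * A ^\<^sub>m Suc l" using assms by (simp add: assoc_mult_mat[of _ n n _ n _ n])
  finally show ?case .
qed

section \<open>The iterates of \<open>W\<close> and their diagonal scalings\<close>

locale rdd_matrix =
  fixes n :: nat and M :: "real mat"
  assumes M: "M \<in> carrier_mat n n" and rdd: "RDD M" and n_pos: "0 < n"
begin

abbreviation d :: "nat \<Rightarrow> real" where "d i \<equiv> M $$ (i, i)"

definition W :: "real mat" where
  "W = (1/2) \<cdot>\<^sub>m (1\<^sub>m n + D_pow M (-1) * AT M)"

lemma d_pos: "i < n \<Longrightarrow> 0 < d i"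
  using rdd M by (auto simp: RDD_def)

lemma AT_carrier [simp]: "AT M \<in> carrier_mat n n"
  using M by (auto simp: AT_def D_mat_def)

lemma AT_index: "i < n \<Longrightarrow> j < n \<Longrightarrow> AT M $$ (i, j) = (if i = j then 0 else - M $$ (i, j))"
  using M by (auto simp: AT_def D_mat_def mat_diag_def)

lemma AT_row_sum_le: "i < n \<Longrightarrow> (\<Sum>j<n. \<bar>AT M $$ (i, j)\<bar>) \<le> d i"
proof -
  assume i: "i < n"
  have "(\<Sum>j<n. \<bar>AT M $$ (i, j)\<bar>) = (\<Sum>j\<in>{..<n} - {i}. \<bar>M $$ (i, j)\<bar>)"
    using i by (intro sum.mono_neutral_cong_right) (auto simp: AT_index)
  also have "\<dots> \<le> d i" using rdd M i by (auto simp: RDD_def)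
  finally show ?thesis .
qed

lemma D_pow_carrier [simp]: "D_pow M r \<in> carrier_mat n n"
  using M by (simp add: D_pow_def)

lemma D_pow_mult:
  "A \<in> carrier_mat n n \<Longrightarrow> D_pow M r * A = Matrix.mat n n (\<lambda>(i, j). d i powr r * A $$ (i, j))"
  "A \<in> carrier_mat n n \<Longrightarrow> A * D_pow M r = Matrix.mat n n (\<lambda>(i, j). A $$ (i, j) * d j powr r)"
  using M by (simp_all add: D_pow_def mat_diag_mult_left mat_diag_mult_right)

lemma W_carrier [simp]: "W \<in> carrier_mat n n"
  by (simp add: W_def D_pow_mult)

lemma W_index: "i < n \<Longrightarrow> j < n \<Longrightarrow> W $$ (i, j) = (of_bool (i = j) + AT M $$ (i, j) / d i) / 2"
  using d_pos[of i] by (simp add: W_def D_pow_mult)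

lemma D_inv_index:
  assumes "v \<in> carrier_vec n" "i < n"
  shows "(D_pow M (-1) *\<^sub>v v) $ i = v $ i / d i"
proof -
  have "(D_pow M (-1) *\<^sub>v v) $ i = (\<Sum>j<n. (if i = j then d i powr (-1) else 0) * v $ j)"
    using M assms by (auto simp: D_pow_def mat_diag_def scalar_prod_def atLeast0LessThan intro!: sum.cong)
  also have "\<dots> = (\<Sum>j<n. if i = j then d i powr (-1) * v $ j else 0)"
    by (intro sum.cong) auto
  also have "\<dots> = v $ i / d i"
    using assms d_pos[of i] by (simp add: powr_minus field_simps)
  finally show ?thesis .
qed

lemma D_inv_carrier: "v \<in> carrier_vec n \<Longrightarrow> D_pow M (-1) *\<^sub>v v \<in> carrier_vec n"
  by (rule mult_mat_vec_carrier[of _ n n]) simp_all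

lemma abs_le_max_norm:
  assumes "v \<in> carrier_vec n" "i < n"
  shows "\<bar>v $ i / d i\<bar> \<le> lp_norm \<infinity> (D_pow M (-1) *\<^sub>v v)"
  using abs_le_lp_norm[of \<infinity> i "D_pow M (-1) *\<^sub>v v"] D_inv_index[OF assms] assms(2)
    carrier_vecD[OF D_inv_carrier[OF assms(1)]]
  by (simp del: dim_mult_mat_vec)

lemma scaled_AT_carrier [simp]: "scaled_AT M p \<in> carrier_mat n n"
  by (simp add: scaled_AT_def Let_def D_pow_mult)

lemma scaled_AT_index:
  assumes "i < n" "j < n" and r: "r = real_of_ereal (1 / p)"
  shows "scaled_AT M p $$ (i, j) = d i powr (r - 1) * AT M $$ (i, j) * d j powr (- r)"
  using assms(1,2) by (simp add: scaled_AT_def Let_def D_pow_mult r)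

text \<open>Entry \<open>i\<close> of the \<open>l\<close>-th power of \<open>W\<close> applied to
  \<open>D_pow M (-1) *\<^sub>v b\<close>. The scalar recursion splits off the first step from
  \<open>i\<close>, which is also how the expectation of a walk unfolds.\<close>

fun iterate :: "real Matrix.vec \<Rightarrow> nat \<Rightarrow> nat \<Rightarrow> real" where
  "iterate b 0 i = b $ i / d i"
| "iterate b (Suc l) i = (\<Sum>j<n. W $$ (i, j) * iterate b l j)"

lemma W_pow_index:
  assumes b: "b \<in> carrier_vec n"
  shows "i < n \<Longrightarrow> ((W ^\<^sub>m l) *\<^sub>v (D_pow M (-1) *\<^sub>v b)) $ i = iterate b l i"
proof (induction l arbitrary: i)
  case 0
  have "1\<^sub>m n *\<^sub>v (D_pow M (-1) *\<^sub>v b) = D_pow M (-1) *\<^sub>v b"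
    using D_inv_carrier[OF b] by simp
  then show ?case using D_inv_index[OF b 0] by (simp add: carrier_matD[OF W_carrier])
next
  case (Suc l)
  let ?c = "D_pow M (-1) *\<^sub>v b"
  have "(W ^\<^sub>m Suc l) *\<^sub>v ?c = W *\<^sub>v ((W ^\<^sub>m l) *\<^sub>v ?c)"
    unfolding pow_mat_Suc_left[OF W_carrier]
    by (rule assoc_mult_mat_vec[of _ n n _ n]) (auto simp: D_inv_carrier[OF b])
  also have "\<dots> $ i = (\<Sum>j<n. W $$ (i, j) * ((W ^\<^sub>m l) *\<^sub>v ?c) $ j)"
    using Suc.prems W_carrier
    by (auto simp: scalar_prod_def atLeast0LessThan carrier_matD[OF W_carrier] intro!: sum.cong)
  also have "\<dots> = iterate b (Suc l) i" using Suc.IH by simp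
  finally show ?case .
qed

text \<open>The identity contributes 1/2 and, by diagonal dominance, the off-diagonal part at most
  1/2. This makes \<open>W\<close> a contraction for the maximum norm and the walk
  substochastic.\<close>

lemma W_row_sum_le: "i < n \<Longrightarrow> (\<Sum>j<n. \<bar>W $$ (i, j)\<bar>) \<le> 1"
proof -
  assume i: "i < n"
  have "(\<Sum>j<n. \<bar>W $$ (i, j)\<bar>) \<le> (\<Sum>j<n. (of_bool (i = j) + \<bar>AT M $$ (i, j)\<bar> / d i) / 2)"
    using i d_pos[OF i] by (intro sum_mono) (auto simp: W_index AT_index abs_mult)
  also have "\<dots> = (1 + (\<Sum>j<n. \<bar>AT M $$ (i, j)\<bar>) / d i) / 2"
    using i by (simp add: sum_divide_distrib[symmetric] sum.distrib of_bool_def)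
  also have "\<dots> \<le> 1" using AT_row_sum_le[OF i] d_pos[OF i] by (simp add: field_simps)
  finally show ?thesis .
qed

lemma iterate_le:
  assumes b: "b \<in> carrier_vec n"
  shows "i < n \<Longrightarrow> \<bar>iterate b l i\<bar> \<le> lp_norm \<infinity> (D_pow M (-1) *\<^sub>v b)"
proof (induction l arbitrary: i)
  case 0
  then show ?case using abs_le_max_norm[OF b] by simp
next
  case (Suc l)
  let ?B = "lp_norm \<infinity> (D_pow M (-1) *\<^sub>v b)"
  have "\<bar>iterate b (Suc l) i\<bar> \<le> (\<Sum>j<n. \<bar>W $$ (i, j)\<bar> * \<bar>iterate b l j\<bar>)"
    by (auto simp: abs_mult[symmetric])
  also have "\<dots> \<le> (\<Sum>j<n. \<bar>W $$ (i, j)\<bar> * ?B)"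
    using Suc.IH by (intro sum_mono mult_left_mono) auto
  also have "\<dots> \<le> 1 * ?B"
    unfolding sum_distrib_right[symmetric] using W_row_sum_le[OF Suc.prems] Suc.IH[OF Suc.prems]
    by (intro mult_right_mono) auto
  finally show ?case by simp
qed

text \<open>Scaling by \<open>D^r\<close> conjugates \<open>W\<close> to \<open>B\<close>, so the
  scaled iterates are successive images under \<open>B\<close> of a vector in \<open>S\<close>, and
  \<open>S\<close> is invariant under \<open>B\<close>. The second claim is needed to multiply the
  bounds: if \<open>S\<close> is trivial, \<open>restr_norm\<close> is a \<open>Sup\<close> of the
  empty set with no known sign, but a nonzero \<open>b\<close> yields a nonzero vector in
  \<open>S\<close>.\<close>

lemma iterate_scaled:
  assumes b: "b \<in> mat_range M" and p: "1 \<le> p" and r: "r = real_of_ereal (1 / p)"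
  defines "B \<equiv> (1/2) \<cdot>\<^sub>m (1\<^sub>m n + scaled_AT M p)" and "S \<equiv> mat_range (1\<^sub>m n - scaled_AT M p)"
  shows "lp_norm p (Matrix.vec n (\<lambda>i. d i powr r * iterate b l i))
      \<le> restr_norm p B S ^ l * lp_norm p (Matrix.vec n (\<lambda>i. d i powr r * iterate b 0 i))"
    and "0 \<le> restr_norm p B S \<or> b = 0\<^sub>v n"
proof -
  let ?A = "scaled_AT M p"
  let ?x = "\<lambda>l. Matrix.vec n (\<lambda>i. d i powr r * iterate b l i)"
  have B: "B \<in> carrier_mat n n" by (simp add: B_def)
  have G: "1\<^sub>m n - ?A \<in> carrier_mat n n" by (simp add: minus_carrier_mat)
  have S: "S = (\<lambda>x. (1\<^sub>m n - ?A) *\<^sub>v x) ` carrier_vec n"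
    by (simp add: S_def mat_range_def carrier_matD[OF scaled_AT_carrier])
  have S_sub: "S \<subseteq> carrier_vec n" unfolding S using G by auto
  have S_smult: "k \<cdot>\<^sub>v v \<in> S" if "v \<in> S" for k v
    using that G unfolding S by (auto simp: mult_mat_vec[symmetric] intro!: imageI)
  \<comment> \<open>Being the identity minus half of \<open>1\<^sub>m n - ?A\<close>, the matrix
    \<open>B\<close> commutes with \<open>1\<^sub>m n - ?A\<close> and preserves its range.\<close>
  have B_eq: "B *\<^sub>v v = v - (1/2) \<cdot>\<^sub>v ((1\<^sub>m n - ?A) *\<^sub>v v)" if v: "v \<in> carrier_vec n" for v
  proof (rule eq_vecI)
    fix i assume "i < dim_vec (v - (1/2) \<cdot>\<^sub>v ((1\<^sub>m n - ?A) *\<^sub>v v))"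
    then have i: "i < n" using G by auto
    have "(1\<^sub>m n *\<^sub>v v) $ i = v $ i" using v by simp
    then have 1: "(\<Sum>j<n. of_bool (i = j) * v $ j) = v $ i"
      using i v by (simp add: scalar_prod_def atLeast0LessThan)
    have "(B *\<^sub>v v) $ i = (\<Sum>j<n. (of_bool (i = j) + ?A $$ (i, j)) / 2 * v $ j)"
      using i v B by (auto simp: B_def scalar_prod_def atLeast0LessThan carrier_matD[OF scaled_AT_carrier] intro!: sum.cong)
    moreover have "((1\<^sub>m n - ?A) *\<^sub>v v) $ i = (\<Sum>j<n. (of_bool (i = j) - ?A $$ (i, j)) * v $ j)"
      using i v by (auto simp: scalar_prod_def atLeast0LessThan carrier_matD[OF scaled_AT_carrier] intro!: sum.cong)
    ultimately show "(B *\<^sub>v v) $ i = (v - (1/2) \<cdot>\<^sub>v ((1\<^sub>m n - ?A) *\<^sub>v v)) $ i"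
      using i 1 v G
      by (simp add: carrier_matD[OF scaled_AT_carrier] ring_distribs sum.distrib sum_subtractf add_divide_distrib flip: sum_divide_distrib)
  qed (use B v in \<open>auto simp: carrier_matD[OF scaled_AT_carrier]\<close>)
  have S_inv: "B *\<^sub>v v \<in> S" if "v \<in> S" for v
  proof -
    from that obtain x where x: "x \<in> carrier_vec n" "v = (1\<^sub>m n - ?A) *\<^sub>v x" unfolding S by auto
    have v: "v \<in> carrier_vec n" using that S_sub by auto
    have "(1\<^sub>m n - ?A) *\<^sub>v (x - (1/2) \<cdot>\<^sub>v v) = (1\<^sub>m n - ?A) *\<^sub>v x - (1/2) \<cdot>\<^sub>v ((1\<^sub>m n - ?A) *\<^sub>v v)"
      using G x(1) v by (simp add: mult_minus_distrib_mat_vec mult_mat_vec)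
    then have "B *\<^sub>v v = (1\<^sub>m n - ?A) *\<^sub>v (x - (1/2) \<cdot>\<^sub>v v)" using B_eq[OF v] x(2) by simp
    then show ?thesis unfolding S using x(1) v by auto
  qed
  \<comment> \<open>The scaling \<open>d j powr r\<close> of the vector cancels the right factor
    \<open>d j powr (- r)\<close> of \<open>?A\<close>; what remains of the left factor is
    \<open>d i powr r\<close> times the \<open>1 / d i\<close> in \<open>W\<close>.\<close>
  have x_Suc: "?x (Suc l) = B *\<^sub>v ?x l" for l
  proof (rule eq_vecI)
    fix i assume "i < dim_vec (B *\<^sub>v ?x l)"
    then have i: "i < n" using B by simp
    have "(B *\<^sub>v ?x l) $ i = (\<Sum>j<n. (of_bool (i = j) + ?A $$ (i, j)) / 2 * (d j powr r * iterate b l j))"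
      using i B by (auto simp: B_def scalar_prod_def atLeast0LessThan carrier_matD[OF scaled_AT_carrier] intro!: sum.cong)
    also have "\<dots> = (\<Sum>j<n. d i powr r * (W $$ (i, j) * iterate b l j))"
    proof (rule sum.cong)
      fix j assume "j \<in> {..<n}"
      then have j: "j < n" by simp
      have "d i powr (r - 1) = d i powr r / d i" "d j powr (- r) * d j powr r = 1"
        using d_pos[OF i] d_pos[OF j] by (simp_all add: powr_diff powr_minus)
      then have "?A $$ (i, j) * d j powr r = d i powr r * AT M $$ (i, j) / d i"
        using scaled_AT_index[OF i j r] by simp
      then show "(of_bool (i = j) + ?A $$ (i, j)) / 2 * (d j powr r * iterate b l j) = d i powr r * (W $$ (i, j) * iterate b l j)"
        unfolding W_index[OF i j] by (cases "i = j") (simp_all add: algebra_simps add_divide_distrib)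
    qed simp
    also have "\<dots> = ?x (Suc l) $ i" using i by (simp add: sum_distrib_left)
    finally show "?x (Suc l) $ i = (B *\<^sub>v ?x l) $ i" by simp
  qed (use B in auto)
  have x0: "?x 0 \<in> S"
  proof -
    from b obtain y where y: "y \<in> carrier_vec n" "b = M *\<^sub>v y" using M by (auto simp: mat_range_def)
    \<comment> \<open>The preimage is \<open>D^r y\<close> where \<open>b = M y\<close>, because
      \<open>(I - ?A) D^r = D^(r-1) (D - A^T) = D^(r-1) M\<close>.\<close>
    let ?z = "Matrix.vec n (\<lambda>i. d i powr r * y $ i)"
    have "?x 0 = (1\<^sub>m n - ?A) *\<^sub>v ?z"
    proof (rule eq_vecI)
      fix i assume "i < dim_vec ((1\<^sub>m n - ?A) *\<^sub>v ?z)"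
      then have i: "i < n" using G by (simp add: carrier_matD[OF scaled_AT_carrier])
      have "((1\<^sub>m n - ?A) *\<^sub>v ?z) $ i = (\<Sum>j<n. (of_bool (i = j) - ?A $$ (i, j)) * (d j powr r * y $ j))"
        using i by (auto simp: scalar_prod_def atLeast0LessThan carrier_matD[OF scaled_AT_carrier] intro!: sum.cong)
      also have "\<dots> = (\<Sum>j<n. d i powr r / d i * (M $$ (i, j) * y $ j))"
      proof (rule sum.cong)
        fix j assume "j \<in> {..<n}"
        then have j: "j < n" by simp
        have "d i powr (r - 1) = d i powr r / d i" "d j powr (- r) * d j powr r = 1"
          using d_pos[OF i] d_pos[OF j] by (simp_all add: powr_diff powr_minus)
        then have "?A $$ (i, j) * d j powr r = d i powr r * AT M $$ (i, j) / d i"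
          using scaled_AT_index[OF i j r] by simp
        then show "(of_bool (i = j) - ?A $$ (i, j)) * (d j powr r * y $ j) = d i powr r / d i * (M $$ (i, j) * y $ j)"
          using d_pos[OF i] unfolding AT_index[OF i j] by (cases "i = j") (simp_all add: algebra_simps)
      qed simp
      also have "\<dots> = ?x 0 $ i"
        using i y M by (simp add: sum_distrib_left scalar_prod_def atLeast0LessThan sum_divide_distrib)
      finally show "?x 0 $ i = ((1\<^sub>m n - ?A) *\<^sub>v ?z) $ i" by simp
    qed (simp add: carrier_matD[OF scaled_AT_carrier])
    then show ?thesis unfolding S by auto
  qed
  have xS: "?x l \<in> S" for l by (induction l) (auto simp: x0 x_Suc S_inv simp del: iterate.simps)
  have step: "lp_norm p (?x (Suc l)) \<le> restr_norm p B S * lp_norm p (?x l)" for l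
    unfolding x_Suc by (rule restr_norm_bound[OF p B n_pos S_sub S_smult xS])
  have nonneg: "0 \<le> lp_norm p (?x l)" for l
    using abs_le_lp_norm[OF p, of 0 "?x l"] n_pos by (simp del: iterate.simps)
  show pos: "0 \<le> restr_norm p B S \<or> b = 0\<^sub>v n"
  proof (rule disjCI)
    assume "b \<noteq> 0\<^sub>v n"
    moreover have bc: "b \<in> carrier_vec n" using b M by (auto simp: mat_range_def)
    ultimately obtain i where i: "i < n" "b $ i \<noteq> 0" by (metis eq_vecI carrier_vecD index_zero_vec)
    have "0 < \<bar>?x 0 $ i\<bar>" using i d_pos[OF i(1)] by simp
    also have "\<dots> \<le> lp_norm p (?x 0)" using i by (intro abs_le_lp_norm p) simp
    finally have "0 < lp_norm p (?x 0)" .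
    moreover have "0 \<le> restr_norm p B S * lp_norm p (?x 0)"
      using step[of 0] nonneg[of 1] by (simp del: iterate.simps)
    ultimately show "0 \<le> restr_norm p B S" by (simp add: zero_le_mult_iff)
  qed
  show "lp_norm p (?x l) \<le> restr_norm p B S ^ l * lp_norm p (?x 0)"
  proof (cases "b = 0\<^sub>v n")
    case True
    have "iterate b l i = 0" if "i < n" for i l
      using that by (induction l arbitrary: i) (auto simp: True)
    then have "?x l = ?x 0" for l by (intro eq_vecI) (auto simp del: iterate.simps)
    moreover have "lp_norm p (?x 0) = 0"
    proof -
      have "?x 0 = 0 \<cdot>\<^sub>v ?x 0" using True by (intro eq_vecI) auto
      then show ?thesis using lp_norm_smult[OF p, of "?x 0" 0] n_pos by simp
    qed
    ultimately show ?thesis by simp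
  next
    case False
    then have "0 \<le> restr_norm p B S" using pos by simp
    then show ?thesis
    proof (induction l)
      case (Suc l)
      have "lp_norm p (?x (Suc l)) \<le> restr_norm p B S * lp_norm p (?x l)" by (rule step)
      also have "\<dots> \<le> restr_norm p B S * (restr_norm p B S ^ l * lp_norm p (?x 0))"
        using Suc by (intro mult_left_mono) auto
      finally show ?case by (simp only: power_Suc mult_ac)
    qed simp
  qed
qed


section \<open>The factors of the logarithm, geometric decay and the tail of the series\<close>

lemma max_norm_attained:
  assumes "v \<in> carrier_vec n"
  obtains i where "i < n" "lp_norm \<infinity> (D_pow M (-1) *\<^sub>v v) = \<bar>v $ i / d i\<bar>"
proof -
  let ?w = "D_pow M (-1) *\<^sub>v v"
  have dim: "dim_vec ?w = n" using D_inv_carrier[OF assms] by (rule carrier_vecD)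
  have "Max ((\<lambda>i. \<bar>?w $ i\<bar>) ` {..<n}) \<in> (\<lambda>i. \<bar>?w $ i\<bar>) ` {..<n}"
    using n_pos by (intro Max_in) auto
  then obtain i where i: "i < n" "Max ((\<lambda>i. \<bar>?w $ i\<bar>) ` {..<n}) = \<bar>?w $ i\<bar>" by auto
  then have "lp_norm \<infinity> ?w = \<bar>v $ i / d i\<bar>"
    unfolding lp_norm_def dim using D_inv_index[OF assms i(1)] by simp
  then show ?thesis using i that by blast
qed

lemma max_norm_pos:
  assumes "v \<in> carrier_vec n" "v \<noteq> 0\<^sub>v n"
  shows "0 < lp_norm \<infinity> (D_pow M (-1) *\<^sub>v v)"
proof -
  obtain i where i: "i < n" "v $ i \<noteq> 0"
    using assms by (metis eq_vecI carrier_vecD index_zero_vec)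
  have "0 < \<bar>v $ i / d i\<bar>" using i d_pos[OF i(1)] by simp
  also have "\<dots> \<le> lp_norm \<infinity> (D_pow M (-1) *\<^sub>v v)" by (rule abs_le_max_norm[OF assms(1) i(1)])
  finally show ?thesis .
qed

lemma l0_norm_pos:
  assumes "v \<in> carrier_vec n" "v \<noteq> 0\<^sub>v n"
  shows "1 \<le> l0_norm v"
proof -
  obtain i where i: "i < n" "v $ i \<noteq> 0"
    using assms by (metis eq_vecI carrier_vecD index_zero_vec)
  then have "card {i. i < dim_vec v \<and> v $ i \<noteq> 0} \<noteq> 0" using assms(1) by auto
  then show ?thesis unfolding l0_norm_def by linarith
qed

lemma d_le_d_max: "i < n \<Longrightarrow> d i \<le> d_max M"
  using M unfolding d_max_def by (intro Max_ge) auto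

lemma d_max_attained: obtains i where "i < n" "d_max M = d i"
proof -
  have "Max (d ` {..<n}) \<in> d ` {..<n}"
    using n_pos by (intro Max_in) auto
  moreover have "d_max M = Max (d ` {..<n})" using M by (simp add: d_max_def)
  ultimately have "d_max M \<in> d ` {..<n}" by simp
  then show ?thesis using that by auto
qed

lemma d_max_pos: "0 < d_max M"
  using d_pos by (metis d_max_attained)

lemma log_arg_pos:
  assumes "b \<in> carrier_vec n" "t \<in> carrier_vec n" "b \<noteq> 0\<^sub>v n" "t \<noteq> 0\<^sub>v n" "0 < \<gamma>" "0 < E"
  shows "0 < log_arg M b t \<gamma> E"
  using assms d_max_pos max_norm_pos[of b] max_norm_pos[of t] l0_norm_pos[of b] l0_norm_pos[of t]
  unfolding log_arg_def by (intro mult_pos_pos) auto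

text \<open>Restricting to a value of \<open>p\<close> at which the gap is at least \<open>\<gamma>/2\<close> makes it unnecessary to
  know that the supremum in \<^const>\<open>gamma_max\<close> is attained.\<close>

lemma geometric_decay:
  assumes b: "b \<in> mat_range M" "b \<noteq> 0\<^sub>v n" and \<gamma>: "0 < \<gamma>" "\<gamma> \<le> gamma_max M"
  obtains \<rho> where "0 \<le> \<rho>" "\<rho> < 1 - \<gamma> / 2"
    "\<And>l t. t \<in> carrier_vec n \<Longrightarrow> (\<Sum>i<n. \<bar>t $ i * iterate b l i\<bar>)
        \<le> \<rho> ^ l * (d_max M * real (l0_norm t) * lp_norm \<infinity> (D_pow M (-1) *\<^sub>v t)
              * real (l0_norm b) * lp_norm \<infinity> (D_pow M (-1) *\<^sub>v b))"
proof -
  have bc: "b \<in> carrier_vec n" using b M by (auto simp: mat_range_def)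
  define N where "N p = restr_norm p ((1/2) \<cdot>\<^sub>m (1\<^sub>m n + scaled_AT M p)) (mat_range (1\<^sub>m n - scaled_AT M p))"
    for p
  have "\<gamma> / 2 < (SUP p\<in>{1..\<infinity>}. 1 - N p)"
    using \<gamma> M unfolding gamma_max_def N_def by simp
  then obtain p where p: "1 \<le> p" "\<gamma> / 2 < 1 - N p"
    by (rule less_cSupE) auto
  define r where "r = real_of_ereal (1 / p)"
  have r: "0 \<le> r" "r \<le> 1"
    using p(1) by (cases rule: ereal_ge_1_cases; simp add: r_def one_ereal_def)+
  let ?x = "\<lambda>l. Matrix.vec n (\<lambda>i. d i powr r * iterate b l i)"
  let ?B = "lp_norm \<infinity> (D_pow M (-1) *\<^sub>v b)"
  have N: "0 \<le> N p" "\<And>l. lp_norm p (?x l) \<le> N p ^ l * lp_norm p (?x 0)"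
    using iterate_scaled[OF b(1) p(1) r_def] b(2) unfolding N_def by auto
  have x0: "lp_norm p (?x 0) \<le> real (l0_norm b) * (d_max M powr r * ?B)"
  proof -
    have "l0_norm (?x 0) = l0_norm b"
      unfolding l0_norm_def using bc d_pos by (intro arg_cong[where f = card]) force
    moreover have "lp_norm p (?x 0) \<le> real (l0_norm (?x 0)) * (d_max M powr r * ?B)"
    proof (rule lp_norm_le[OF p(1)])
      fix i assume "i < dim_vec (?x 0)"
      then have i: "i < n" by simp
      have "\<bar>?x 0 $ i\<bar> = d i powr r * \<bar>b $ i / d i\<bar>" using i by (simp add: abs_mult)
      also have "\<dots> \<le> d_max M powr r * ?B"
        using d_pos[OF i] d_le_d_max[OF i] r abs_le_max_norm[OF bc i]
        by (intro mult_mono powr_mono2) auto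
      finally show "\<bar>?x 0 $ i\<bar> \<le> d_max M powr r * ?B" .
    qed (use n_pos in simp)
    ultimately show ?thesis by simp
  qed
  show ?thesis
  proof (rule that[OF N(1)])
    show "N p < 1 - \<gamma> / 2" using p(2) by simp
  next
    fix l and t :: "real Matrix.vec" assume t: "t \<in> carrier_vec n"
    let ?T = "lp_norm \<infinity> (D_pow M (-1) *\<^sub>v t)"
    \<comment> \<open>The weight \<open>d i\<close> is split between the two vectors:
      \<open>d i powr (1 - r)\<close> goes with \<open>t\<close> and \<open>d i powr r\<close> with
      the scaled iterate. The two bounds recombine to a single factor \<open>d_max M\<close>,
      whatever \<open>r\<close> is.\<close>
    have dm: "d_max M powr (1 - r) * d_max M powr r = d_max M"
      using d_max_pos by (simp add: powr_add[symmetric])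
    have "(\<Sum>i<n. \<bar>t $ i * iterate b l i\<bar>) = (\<Sum>i | i < n \<and> t $ i \<noteq> 0. \<bar>t $ i * iterate b l i\<bar>)"
      by (intro sum.mono_neutral_right) auto
    also have "\<dots> \<le> (\<Sum>i | i < n \<and> t $ i \<noteq> 0. (d_max M powr (1 - r) * ?T) * lp_norm p (?x l))"
    proof (rule sum_mono)
      fix i assume "i \<in> {i. i < n \<and> t $ i \<noteq> 0}"
      then have i: "i < n" by simp
      have "\<bar>t $ i * iterate b l i\<bar> = (d i powr (1 - r) * \<bar>t $ i / d i\<bar>) * \<bar>?x l $ i\<bar>"
        using i d_pos[OF i] by (simp add: abs_mult powr_diff)
      also have "\<dots> \<le> (d_max M powr (1 - r) * ?T) * lp_norm p (?x l)"
        using i d_pos[OF i] d_le_d_max[OF i] r abs_le_lp_norm[OF p(1), of i "?x l"]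
          abs_le_max_norm[OF t i] order_trans[OF abs_ge_zero abs_le_max_norm[OF t i]]
        by (intro mult_mono powr_mono2 mult_nonneg_nonneg) auto
      finally show "\<bar>t $ i * iterate b l i\<bar> \<le> (d_max M powr (1 - r) * ?T) * lp_norm p (?x l)" .
    qed
    also have "\<dots> = real (l0_norm t) * ((d_max M powr (1 - r) * ?T) * lp_norm p (?x l))"
      using t by (simp add: l0_norm_def)
    also have "\<dots> \<le> real (l0_norm t) * ((d_max M powr (1 - r) * ?T) *
        (N p ^ l * (real (l0_norm b) * (d_max M powr r * ?B))))"
    proof (intro mult_left_mono)
      have "lp_norm p (?x l) \<le> N p ^ l * lp_norm p (?x 0)" by (rule N(2))
      also have "\<dots> \<le> N p ^ l * (real (l0_norm b) * (d_max M powr r * ?B))"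
        using x0 N(1) by (intro mult_left_mono) auto
      finally show "lp_norm p (?x l) \<le> N p ^ l * (real (l0_norm b) * (d_max M powr r * ?B))" .
      show "0 \<le> d_max M powr (1 - r) * ?T" 
        using order_trans[OF abs_ge_zero abs_le_max_norm[OF t n_pos]] by simp
    qed auto
    also have "\<dots> = N p ^ l * ((d_max M powr (1 - r) * d_max M powr r) * real (l0_norm t) * ?T * real (l0_norm b) * ?B)"
      by (simp only: mult_ac)
    finally show "(\<Sum>i<n. \<bar>t $ i * iterate b l i\<bar>) \<le> N p ^ l * (d_max M * real (l0_norm t) * ?T * real (l0_norm b) * ?B)"
      unfolding dm .
  qed
qed

text \<open>The nonnegative rate \<open>\<rho>\<close> below \<open>1 - \<gamma> / 2\<close> leaves
  no other possibility.\<close>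

lemma gamma_less_2:
  assumes "b \<in> mat_range M" "b \<noteq> 0\<^sub>v n" "0 < \<gamma>" "\<gamma> \<le> gamma_max M"
  shows "\<gamma> < 2"
  by (rule geometric_decay[OF assms]) linarith

text \<open>The tail from \<open>m\<close> on is geometric with rate \<open>\<rho>\<close>, and
  \<open>m\<close> is large enough to bring it down to \<open>E\<close>; the factor 1/2 in
  \<open>x_star\<close> halves this.\<close>

lemma truncation_error:
  assumes b: "b \<in> mat_range M" "b \<noteq> 0\<^sub>v n" and t: "t \<in> carrier_vec n" "t \<noteq> 0\<^sub>v n"
    and \<gamma>: "0 < \<gamma>" "\<gamma> \<le> gamma_max M" and E: "0 < E" and U: "log_arg M b t \<gamma> E \<le> U"
    and m: "4 / \<gamma> * ln (U + 3) \<le> real m"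
  shows "\<bar>scalar_prod t (x_star M b) - (\<Sum>i<n. t $ i * (\<Sum>l<m. iterate b l i)) / 2\<bar> \<le> E / 2"
proof -
  have bc: "b \<in> carrier_vec n" using b M by (auto simp: mat_range_def)
  have la: "0 < log_arg M b t \<gamma> E" using log_arg_pos[OF bc t(1) b(2) t(2) \<gamma>(1) E] .
  obtain \<rho> where \<rho>: "0 \<le> \<rho>" "\<rho> < 1 - \<gamma> / 2"
    and decay: "\<And>l t. t \<in> carrier_vec n \<Longrightarrow> (\<Sum>i<n. \<bar>t $ i * iterate b l i\<bar>)
        \<le> \<rho> ^ l * (d_max M * real (l0_norm t) * lp_norm \<infinity> (D_pow M (-1) *\<^sub>v t)
              * real (l0_norm b) * lp_norm \<infinity> (D_pow M (-1) *\<^sub>v b))"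
    using geometric_decay[OF b \<gamma>] by blast
  have \<rho>1: "\<rho> < 1" using \<rho> \<gamma> by linarith
  \<comment> \<open>Multiplying by \<open>\<gamma> * E\<close> removes the normalisation of
    \<open>log_arg\<close> and leaves exactly the constant of the decay estimate.\<close>
  define F where "F = \<gamma> * E * log_arg M b t \<gamma> E"
  have F: "(\<Sum>i<n. \<bar>t $ i * iterate b l i\<bar>) \<le> \<rho> ^ l * F" for l
    using decay[OF t(1), of l] \<gamma>(1) E by (simp add: F_def log_arg_def)
  have sum_u: "summable (\<lambda>l. iterate b l i)" if i: "i < n" for i
  proof -
    \<comment> \<open>The decay estimate bounds sums weighted by a vector; a unit vector isolates a
      single coordinate.\<close>
    let ?e = "unit_vec n i :: real Matrix.vec"
    obtain c where c: "\<And>l. (\<Sum>j<n. \<bar>?e $ j * iterate b l j\<bar>) \<le> \<rho> ^ l * c"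
      using decay[of ?e] by auto
    have "norm (iterate b l i) \<le> c * \<rho> ^ l" for l
    proof -
      have "norm (iterate b l i) = \<bar>?e $ i * iterate b l i\<bar>" using i by simp
      also have "\<dots> \<le> (\<Sum>j<n. \<bar>?e $ j * iterate b l j\<bar>)"
        using i by (intro member_le_sum) auto
      finally show ?thesis using c[of l] by (simp add: mult.commute)
    qed
    moreover have "summable (\<lambda>l. c * \<rho> ^ l)"
      using \<rho>(1) \<rho>1 by (intro summable_mult summable_geometric) simp
    ultimately show ?thesis by (rule summable_comparison_test'[rotated])
  qed
  define s where "s l = (\<Sum>i<n. t $ i * iterate b l i)" for l
  have s_le: "norm (s l) \<le> F * \<rho> ^ l" for l
    using order_trans[OF sum_abs F[of l]] by (simp add: s_def mult.commute)
  have s_sum: "summable s"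
    unfolding s_def by (intro summable_sum summable_mult sum_u) simp
  have geo: "summable (\<lambda>l. F * \<rho> ^ (l + m))"
    using \<rho> \<rho>1 by (auto simp: power_add intro!: summable_mult summable_mult2 summable_geometric)
  have "scalar_prod t (x_star M b) = (\<Sum>i<n. t $ i * (1/2 * (\<Sum>l. iterate b l i)))"
    using M t W_pow_index[OF bc]
    by (auto simp: x_star_def Let_def scalar_prod_def atLeast0LessThan W_def[symmetric] intro!: sum.cong)
  also have "\<dots> = (\<Sum>i<n. \<Sum>l. t $ i * iterate b l i) / 2"
    unfolding sum_divide_distrib using sum_u by (intro sum.cong) (auto simp: suminf_mult)
  also have "(\<Sum>i<n. \<Sum>l. t $ i * iterate b l i) = (\<Sum>l. s l)"
    unfolding s_def by (intro suminf_sum[symmetric] summable_mult sum_u) simp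
  also have "\<dots> = (\<Sum>l. s (l + m)) + (\<Sum>l<m. s l)"
    by (rule suminf_split_initial_segment[OF s_sum])
  also have "(\<Sum>l<m. s l) = (\<Sum>i<n. t $ i * (\<Sum>l<m. iterate b l i))"
    unfolding s_def sum_distrib_left by (rule sum.swap)
  finally have "scalar_prod t (x_star M b) - (\<Sum>i<n. t $ i * (\<Sum>l<m. iterate b l i)) / 2 = (\<Sum>l. s (l + m)) / 2"
    by (simp add: add_divide_distrib)
  moreover have "norm (\<Sum>l. s (l + m)) \<le> E"
  proof -
    have "norm (\<Sum>l. s (l + m)) \<le> (\<Sum>l. F * \<rho> ^ (l + m))"
      using s_le geo by (intro norm_suminf_le) auto
    also have "\<dots> = F * \<rho> ^ m / (1 - \<rho>)"
    proof -
      have "(\<lambda>l. F * \<rho> ^ (l + m)) = (\<lambda>l. (F * \<rho> ^ m) * \<rho> ^ l)"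
        by (simp add: power_add mult.commute mult.left_commute)
      moreover have "(\<Sum>l. (F * \<rho> ^ m) * \<rho> ^ l) = (F * \<rho> ^ m) * (1 / (1 - \<rho>))"
        using \<rho>(1) \<rho>1 by (subst suminf_mult) (auto simp: suminf_geometric summable_geometric)
      ultimately show ?thesis by simp
    qed
    \<comment> \<open>Since \<open>1 - \<rho>\<close> exceeds \<open>\<gamma> / 2\<close>, the
      geometric series costs a factor \<open>2 / \<gamma>\<close>, which the \<open>\<gamma>\<close>
      in \<open>F\<close> absorbs.\<close>
    also have "\<dots> \<le> F * \<rho> ^ m / (\<gamma> / 2)"
      using \<rho> \<gamma> E la by (intro divide_left_mono) (auto simp: F_def)
    also have "\<dots> = 2 * E * (log_arg M b t \<gamma> E * \<rho> ^ m)"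
      using \<gamma> by (simp add: F_def)
    also have "\<dots> \<le> 2 * E * (1 / 2)"
    proof (intro mult_left_mono)
      have "\<rho> \<le> exp (- \<gamma> / 2)" using \<rho>(2) exp_ge_add_one_self[of "- \<gamma> / 2"] by simp
      then have "\<rho> ^ m \<le> exp (- \<gamma> / 2) ^ m" using \<rho>(1) by (rule power_mono)
      also have "\<dots> = exp (- (\<gamma> / 2 * real m))" by (simp add: exp_of_nat_mult[symmetric] mult.commute)
      \<comment> \<open>The constant 4 in the bound on \<open>m\<close> yields the square of
        \<open>U + 3\<close>: one power beats \<open>log_arg\<close>, the other the remaining factor
        2.\<close>
      also have "\<dots> \<le> exp (- (2 * ln (U + 3)))"
        using m \<gamma> by (simp add: field_simps)
      also have "\<dots> = 1 / (U + 3)\<^sup>2"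
        using la U by (simp add: exp_minus exp_double inverse_eq_divide)
      finally have "log_arg M b t \<gamma> E * \<rho> ^ m \<le> U * (1 / (U + 3)\<^sup>2)"
        using la U \<rho> by (intro mult_mono) auto
      also have "\<dots> \<le> 1 / 2"
      proof -
        have "2 * U \<le> (U + 3)\<^sup>2" using la U by (simp add: power2_eq_square algebra_simps)
        then show ?thesis using la U by (simp add: field_simps)
      qed
      finally show "log_arg M b t \<gamma> E * \<rho> ^ m \<le> 1 / 2" .
    qed (use E in simp)
    finally show ?thesis by simp
  qed
  ultimately show ?thesis by (simp only: abs_divide real_norm_def)
qed

end

section \<open>The random walk estimator\<close>

text \<open>One notion serves both loops of the program: the steps of a walk, and the walks
  themselves with their running total as the state.\<close>

primrec iter_pmf :: "('a \<Rightarrow> 'a pmf) \<Rightarrow> nat \<Rightarrow> 'a \<Rightarrow> 'a pmf" where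
  "iter_pmf K 0 a = return_pmf a"
| "iter_pmf K (Suc k) a = bind_pmf (K a) (iter_pmf K k)"

lemma finite_set_iter_pmf:
  assumes "\<And>a. finite (set_pmf (K a))"
  shows "finite (set_pmf (iter_pmf K k a))"
  by (induction k arbitrary: a) (auto simp: assms)

lemma expectation_bind_pmf:
  fixes h :: "'b \<Rightarrow> real"
  assumes "finite (set_pmf p)" "\<And>x. x \<in> set_pmf p \<Longrightarrow> finite (set_pmf (f x))"
  shows "measure_pmf.expectation (bind_pmf p f) h
    = measure_pmf.expectation p (\<lambda>x. measure_pmf.expectation (f x) h)"
proof -
  have "measure_pmf.expectation (bind_pmf p f) h
      = (\<Sum>a\<in>set_pmf p. pmf p a *\<^sub>R measure_pmf.expectation (f a) h)"
    using assms by (intro pmf_expectation_bind) auto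
  also have "\<dots> = measure_pmf.expectation p (\<lambda>x. measure_pmf.expectation (f x) h)"
    using assms(1) by (intro integral_measure_pmf[symmetric]) auto
  finally show ?thesis .
qed

lemma expectation_cong_pmf:
  fixes f g :: "'a \<Rightarrow> real"
  assumes "\<And>x. x \<in> set_pmf p \<Longrightarrow> f x = g x"
  shows "measure_pmf.expectation p f = measure_pmf.expectation p g"
  using assms by (intro integral_cong_AE) (auto simp: AE_measure_pmf_iff)

lemma expectation_mono_pmf:
  fixes f g :: "'a \<Rightarrow> real"
  assumes "finite (set_pmf p)" "\<And>x. x \<in> set_pmf p \<Longrightarrow> f x \<le> g x"
  shows "measure_pmf.expectation p f \<le> measure_pmf.expectation p g"
  using assms by (intro integral_mono_AE) (auto simp: AE_measure_pmf_iff integrable_measure_pmf_finite)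

text \<open>The increments of the iteration are uncorrelated, so their variances add up.\<close>

lemma iter_pmf_second_moment:
  fixes K :: "real \<Rightarrow> real pmf"
  assumes fin: "\<And>a. finite (set_pmf (K a))"
    and mean: "\<And>a. measure_pmf.expectation (K a) (\<lambda>x. x) = a + \<mu>"
    and bound: "\<And>a x. x \<in> set_pmf (K a) \<Longrightarrow> \<bar>x - a\<bar> \<le> v"
  shows "measure_pmf.expectation (iter_pmf K N a) (\<lambda>x. (x - c)\<^sup>2) \<le> (a + real N * \<mu> - c)\<^sup>2 + real N * v\<^sup>2"
proof (induction N arbitrary: a)
  case 0
  then show ?case by simp
next
  case (Suc N)
  note I = integrable_measure_pmf_finite[OF fin]
  let ?e = "a + real (Suc N) * \<mu> - c"
  have "measure_pmf.expectation (iter_pmf K (Suc N) a) (\<lambda>x. (x - c)\<^sup>2)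
     = measure_pmf.expectation (K a) (\<lambda>y. measure_pmf.expectation (iter_pmf K N y) (\<lambda>x. (x - c)\<^sup>2))"
    by (simp add: expectation_bind_pmf fin finite_set_iter_pmf)
  \<comment> \<open>The induction hypothesis is quadratic in \<open>y\<close>. Written as
    \<open>(y - a)\<^sup>2\<close>, bounded by \<open>v\<^sup>2\<close>, plus a function affine in
    \<open>y\<close>, it can be averaged using the mean alone.\<close>
  also have "\<dots> \<le> measure_pmf.expectation (K a) (\<lambda>y. 2 * (?e - \<mu>) * y +
      (v\<^sup>2 + 2 * \<mu> * a + \<mu>\<^sup>2 - 2 * ?e * (a + \<mu>) + ?e\<^sup>2 + real N * v\<^sup>2))"
  proof (rule expectation_mono_pmf[OF fin])
    fix y assume y: "y \<in> set_pmf (K a)"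
    have "(y - a)\<^sup>2 \<le> v\<^sup>2" using bound[OF y] by (metis abs_ge_zero power2_abs power_mono)
    moreover have "(y + real N * \<mu> - c)\<^sup>2 = (y - a)\<^sup>2 + 2 * (?e - \<mu>) * y
        + (2 * \<mu> * a + \<mu>\<^sup>2 - 2 * ?e * (a + \<mu>) + ?e\<^sup>2)"
      by (simp add: power2_eq_square algebra_simps)
    ultimately show "measure_pmf.expectation (iter_pmf K N y) (\<lambda>x. (x - c)\<^sup>2)
        \<le> 2 * (?e - \<mu>) * y + (v\<^sup>2 + 2 * \<mu> * a + \<mu>\<^sup>2 - 2 * ?e * (a + \<mu>) + ?e\<^sup>2 + real N * v\<^sup>2)"
      using Suc.IH[of y] by linarith
  qed
  also have "\<dots> = 2 * (?e - \<mu>) * (a + \<mu>)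
      + (v\<^sup>2 + 2 * \<mu> * a + \<mu>\<^sup>2 - 2 * ?e * (a + \<mu>) + ?e\<^sup>2 + real N * v\<^sup>2)"
    by (subst Bochner_Integration.integral_add) (auto simp: I mean)
  also have "\<dots> = ?e\<^sup>2 - \<mu>\<^sup>2 + real (Suc N) * v\<^sup>2"
    by (simp add: power2_eq_square algebra_simps)
  finally show ?case using zero_le_power2[of \<mu>] by linarith
qed

text \<open>A deviation beyond \<open>\<delta>\<close> has square at least
  \<open>\<delta>\<^sup>2\<close>, four times the bound on the mean square, so Markov's inequality
  gives probability at most 1/4.\<close>

lemma Markov_second_moment_pmf:
  fixes p :: "real pmf"
  assumes fin: "finite (set_pmf p)" and \<delta>: "0 < \<delta>"
    and le: "measure_pmf.expectation p (\<lambda>x. (x - c)\<^sup>2) \<le> \<delta>\<^sup>2 / 4"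
  shows "3 / 4 \<le> measure (measure_pmf p) {x. \<bar>x - c\<bar> \<le> \<delta>}"
proof -
  have "measure (measure_pmf p) (- {x. \<bar>x - c\<bar> \<le> \<delta>}) \<le> measure (measure_pmf p) {x \<in> space p. \<delta>\<^sup>2 \<le> (x - c)\<^sup>2}"
  proof (rule measure_pmf.finite_measure_mono)
    show "- {x. \<bar>x - c\<bar> \<le> \<delta>} \<subseteq> {x \<in> space p. \<delta>\<^sup>2 \<le> (x - c)\<^sup>2}"
      using \<delta> by (auto simp: power_mono[of \<delta> "\<bar>_\<bar>" 2, simplified])
  qed simp
  also have "\<dots> \<le> measure_pmf.expectation p (\<lambda>x. (x - c)\<^sup>2) / \<delta>\<^sup>2"
    using \<delta> fin by (intro integral_Markov_inequality_measure[where A = "space p"] integrable_measure_pmf_finite) auto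
  also have "\<dots> \<le> 1 / 4" using le \<delta> by (simp add: field_simps)
  finally show ?thesis
    using measure_pmf.prob_compl[of "{x. \<bar>x - c\<bar> \<le> \<delta>}" p] by (simp add: Compl_eq_Diff_UNIV)
qed

section \<open>The starting distribution and the signed walk\<close>

lemma lp_norm_1: "lp_norm 1 v = (\<Sum>i<dim_vec v. \<bar>v $ i\<bar>)"
  by (simp add: lp_norm_def one_ereal_def sum_nonneg)

lemma lp_norm_1_pos:
  assumes "t \<in> carrier_vec n" "t \<noteq> 0\<^sub>v n"
  shows "0 < lp_norm 1 t"
proof -
  obtain i where i: "i < n" "t $ i \<noteq> 0"
    using assms by (metis eq_vecI carrier_vecD index_zero_vec)
  then show ?thesis using assms(1) by (auto simp: lp_norm_1 intro!: sum_pos2[of _ i])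
qed

text \<open>\<open>embed_pmf\<close> has the intended values only for a function of total mass 1;
  dividing by the positive \<open>lp_norm 1 t\<close> provides that.\<close>

lemma
  assumes t: "t \<in> carrier_vec n" "t \<noteq> 0\<^sub>v n"
  shows pmf_target: "pmf (target_pmf t) i = (if i < n then \<bar>t $ i\<bar> / lp_norm 1 t else 0)"
    and set_target_pmf: "set_pmf (target_pmf t) \<subseteq> {..<n}"
proof -
  let ?f = "\<lambda>i. if i < dim_vec t then \<bar>t $ i\<bar> / lp_norm 1 t else 0"
  have p: "0 < lp_norm 1 t" by (rule lp_norm_1_pos[OF t])
  have "(\<integral>\<^sup>+ i. ennreal (?f i) \<partial>count_space UNIV) = (\<Sum>i<n. ennreal (?f i))"
    using t(1) by (intro nn_integral_count_space'[of "{..<n}"]) auto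
  also have "\<dots> = ennreal (\<Sum>i<n. ?f i)" using p by (intro sum_ennreal) auto
  also have "(\<Sum>i<n. ?f i) = 1"
    using p t(1) by (simp add: lp_norm_1 flip: sum_divide_distrib)
  finally have "pmf (target_pmf t) i = ?f i" for i
    unfolding target_pmf_def using p by (intro pmf_embed_pmf) auto
  then show pmf: "pmf (target_pmf t) i = (if i < n then \<bar>t $ i\<bar> / lp_norm 1 t else 0)" for i
    using t(1) by simp
  show "set_pmf (target_pmf t) \<subseteq> {..<n}" by (auto simp: set_pmf_iff pmf split: if_splits)
qed

context rdd_matrix
begin

lemma walk_matrix_index: "i < n \<Longrightarrow> j < n \<Longrightarrow> walk_matrix M $$ (i, j) = \<bar>W $$ (i, j)\<bar>"
  using M d_pos[of i] by (auto simp: walk_matrix_def D_pow_mult W_index AT_index carrier_matD[OF AT_carrier])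

text \<open>Separates transition probability from sign, so that averaging products of signs over the
  walk recovers powers of the signed matrix \<open>W\<close>.\<close>

lemma W_eq_sign: "i < n \<Longrightarrow> j < n \<Longrightarrow> W $$ (i, j) = \<bar>W $$ (i, j)\<bar> * walk_sign M i j"
  using d_pos[of i] by (auto simp: W_index walk_sign_def AT_index sgn_if)

text \<open>\<open>W_row_sum_le\<close> is the bound on the mass under which
  \<open>embed_spmf\<close> reproduces its argument.\<close>

lemma pmf_walk_step:
  assumes i: "i < n"
  shows "pmf (walk_step M i) (Some j) = (if j < n then \<bar>W $$ (i, j)\<bar> else 0)"
proof -
  let ?f = "\<lambda>j. if i < dim_row M \<and> j < dim_row M then walk_matrix M $$ (i, j) else 0"
  have f: "?f j = (if j < n then \<bar>W $$ (i, j)\<bar> else 0)" for j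
    using i M walk_matrix_index[OF i] by auto
  have "(\<integral>\<^sup>+ j. ennreal (?f j) \<partial>count_space UNIV) = (\<Sum>j<n. ennreal (?f j))"
    unfolding f by (intro nn_integral_count_space'[of "{..<n}"]) auto
  also have "\<dots> = ennreal (\<Sum>j<n. \<bar>W $$ (i, j)\<bar>)" unfolding f by simp
  also have "\<dots> \<le> 1" using W_row_sum_le[OF i] by simp
  finally show ?thesis unfolding walk_step_def by (subst spmf_embed_spmf) (simp_all only: f, simp_all)
qed

lemma walk_step_set: "set_pmf (walk_step M i) \<subseteq> insert None (Some ` {..<n})"
proof (cases "i < n")
  case True
  show ?thesis
  proof
    fix r assume r: "r \<in> set_pmf (walk_step M i)"
    then show "r \<in> insert None (Some ` {..<n})"
      by (cases r) (auto simp: set_pmf_iff pmf_walk_step[OF True] split: if_splits)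
  qed
next
  case False
  then show ?thesis using M by (simp add: walk_step_def)
qed

lemma finite_walk_step: "finite (set_pmf (walk_step M i))"
  by (rule finite_subset[OF walk_step_set]) simp

lemma expectation_walk_step:
  assumes i: "i < n"
  shows "measure_pmf.expectation (walk_step M i) (case_option 0 h) = (\<Sum>j<n. \<bar>W $$ (i, j)\<bar> * h j)"
proof -
  have "measure_pmf.expectation (walk_step M i) (case_option 0 h)
      = (\<Sum>r\<in>insert None (Some ` {..<n}). pmf (walk_step M i) r *\<^sub>R case_option 0 h r)"
    using walk_step_set[of i] by (intro integral_measure_pmf) auto
  also have "\<dots> = (\<Sum>j<n. \<bar>W $$ (i, j)\<bar> * h j)"
    by (subst sum.insert) (auto simp: sum.reindex pmf_walk_step[OF i])
  finally show ?thesis .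
qed

text \<open>The components of a state are the position of the walk, the product of the signs traversed
  so far (0 after termination), and the accumulated sum.\<close>

fun walk_kernel :: "real Matrix.vec \<Rightarrow> nat \<times> real \<times> real \<Rightarrow> (nat \<times> real \<times> real) pmf" where
  "walk_kernel b (i, w, z) = map_pmf
     (\<lambda>r. case r of None \<Rightarrow> (i, 0, z + b $ i / d i * w)
           | Some j \<Rightarrow> (j, w * walk_sign M i j, z + b $ i / d i * w)) (walk_step M i)"

lemma finite_walk_kernel: "finite (set_pmf (walk_kernel b a))"
  by (cases a) (auto simp: finite_walk_step)

text \<open>Conditioning on the first step: the start contributes the term \<open>l = 0\<close>, and
  averaging the remaining sums over the successor applies \<open>W\<close> once, shifting every
  index by one. The result is linear in \<open>w\<close>, so a terminated walk, with weight 0,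
  correctly adds nothing more.\<close>

lemma walk_mean:
  "i < n \<Longrightarrow> measure_pmf.expectation (iter_pmf (walk_kernel b) k (i, w, z)) (\<lambda>a. snd (snd a))
     = z + w * (\<Sum>l<k. iterate b l i)"
proof (induction k arbitrary: i w z)
  case 0
  then show ?case by simp
next
  case (Suc k)
  let ?z = "z + b $ i / d i * w"
  let ?s = "\<lambda>j. \<Sum>l<k. iterate b l j"
  have "measure_pmf.expectation (iter_pmf (walk_kernel b) (Suc k) (i, w, z)) (\<lambda>a. snd (snd a))
    = measure_pmf.expectation (walk_kernel b (i, w, z))
        (\<lambda>a. measure_pmf.expectation (iter_pmf (walk_kernel b) k a) (\<lambda>a. snd (snd a)))"
    unfolding iter_pmf.simps by (intro expectation_bind_pmf finite_walk_kernel finite_set_iter_pmf)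
  also have "\<dots> = measure_pmf.expectation (walk_step M i)
      (\<lambda>r. ?z + case_option 0 (\<lambda>j. w * walk_sign M i j * ?s j) r)"
    unfolding walk_kernel.simps integral_map_pmf
  proof (rule expectation_cong_pmf)
    fix r assume "r \<in> set_pmf (walk_step M i)"
    then have "r \<in> insert None (Some ` {..<n})" using walk_step_set by blast
    then show "measure_pmf.expectation (iter_pmf (walk_kernel b) k
        (case r of None \<Rightarrow> (i, 0, ?z) | Some j \<Rightarrow> (j, w * walk_sign M i j, ?z))) (\<lambda>a. snd (snd a))
      = ?z + case_option 0 (\<lambda>j. w * walk_sign M i j * ?s j) r"
      using Suc.IH Suc.prems by auto
  qed
  also have "\<dots> = ?z + measure_pmf.expectation (walk_step M i) (case_option 0 (\<lambda>j. w * walk_sign M i j * ?s j))"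
    by (subst Bochner_Integration.integral_add) (auto intro!: integrable_measure_pmf_finite finite_walk_step)
  also have "\<dots> = ?z + (\<Sum>j<n. \<bar>W $$ (i, j)\<bar> * (w * walk_sign M i j * ?s j))"
    by (simp add: expectation_walk_step[OF Suc.prems])
  also have "(\<Sum>j<n. \<bar>W $$ (i, j)\<bar> * (w * walk_sign M i j * ?s j)) = (\<Sum>j<n. w * (W $$ (i, j) * ?s j))"
  proof (rule sum.cong)
    fix j assume "j \<in> {..<n}"
    then have "W $$ (i, j) = \<bar>W $$ (i, j)\<bar> * walk_sign M i j" using W_eq_sign[OF Suc.prems] by simp
    then show "\<bar>W $$ (i, j)\<bar> * (w * walk_sign M i j * ?s j) = w * (W $$ (i, j) * ?s j)"
      by (metis mult.assoc mult.left_commute)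
  qed simp
  also have "\<dots> = w * (\<Sum>l<k. iterate b (Suc l) i)"
    by (simp add: sum_distrib_left sum.swap[of _ "{..<k}"])
  finally show ?case
    by (simp add: sum.lessThan_Suc_shift algebra_simps del: sum.lessThan_Suc iterate.simps(2))
qed

text \<open>Signs never increase the weight in absolute value, so each step adds at most
  \<open>\<bar>w\<bar>\<close> times the maximum norm. Holding for every outcome, this is the
  increment bound that the second moment requires.\<close>

lemma walk_bound:
  assumes b: "b \<in> carrier_vec n"
  shows "i < n \<Longrightarrow> a \<in> set_pmf (iter_pmf (walk_kernel b) k (i, w, z)) \<Longrightarrow>
    \<bar>snd (snd a) - z\<bar> \<le> real k * \<bar>w\<bar> * lp_norm \<infinity> (D_pow M (-1) *\<^sub>v b)"
proof (induction k arbitrary: i w z)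
  case 0
  then show ?case by simp
next
  case (Suc k)
  let ?z = "z + b $ i / d i * w"
  let ?B = "lp_norm \<infinity> (D_pow M (-1) *\<^sub>v b)"
  have B: "\<bar>b $ i / d i\<bar> \<le> ?B" by (rule abs_le_max_norm[OF b Suc.prems(1)])
  have B0: "0 \<le> ?B" using B by linarith
  from Suc.prems(2) obtain r where r: "r \<in> set_pmf (walk_step M i)"
    "a \<in> set_pmf (iter_pmf (walk_kernel b) k
        (case r of None \<Rightarrow> (i, 0, ?z) | Some j \<Rightarrow> (j, w * walk_sign M i j, ?z)))"
    by (auto simp del: times_divide_eq_left)
  have "r \<in> insert None (Some ` {..<n})" using r(1) walk_step_set by blast
  then have "\<bar>snd (snd a) - ?z\<bar> \<le> real k * \<bar>w\<bar> * ?B"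
  proof
    assume "r = None"
    then have "\<bar>snd (snd a) - ?z\<bar> \<le> real k * \<bar>0\<bar> * ?B"
      using r(2) by (intro Suc.IH[OF Suc.prems(1)]) simp
    also have "\<dots> \<le> real k * \<bar>w\<bar> * ?B" using B0 by simp
    finally show ?thesis .
  next
    assume "r \<in> Some ` {..<n}"
    then obtain j where j: "j < n" "r = Some j" by auto
    have "\<bar>snd (snd a) - ?z\<bar> \<le> real k * \<bar>w * walk_sign M i j\<bar> * ?B"
      using r(2) j(2) by (intro Suc.IH[OF j(1)]) simp
    also have "\<dots> \<le> real k * \<bar>w\<bar> * ?B"
      using B0 by (intro mult_right_mono mult_left_mono) (auto simp: abs_mult walk_sign_def sgn_if)
    finally show ?thesis .
  qed
  moreover have "\<bar>b $ i / d i * w\<bar> \<le> ?B * \<bar>w\<bar>"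
    unfolding abs_mult using B by (intro mult_right_mono) auto
  ultimately have "\<bar>snd (snd a) - z\<bar> \<le> real k * \<bar>w\<bar> * ?B + ?B * \<bar>w\<bar>" by linarith
  then show ?case by (simp add: algebra_simps)
qed

text \<open>The walk accumulates directly onto the running total \<open>a\<close>, as the program
  does, and its initial weight carries the sign of \<open>t $ i\<close>. The weight -1 at a zero
  entry is harmless, as such an \<open>i\<close> has probability 0.\<close>

definition sample_kernel :: "real Matrix.vec \<Rightarrow> real Matrix.vec \<Rightarrow> nat \<Rightarrow> real \<Rightarrow> real pmf" where
  "sample_kernel b t m a = bind_pmf (target_pmf t) (\<lambda>i.
     map_pmf (\<lambda>a. snd (snd a)) (iter_pmf (walk_kernel b) m (i, if 0 < t $ i then 1 else -1, a)))"

context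
  fixes b t :: "real Matrix.vec"
  assumes b: "b \<in> carrier_vec n" "b \<noteq> 0\<^sub>v n" and t: "t \<in> carrier_vec n" "t \<noteq> 0\<^sub>v n"
begin

lemma finite_sample_kernel: "finite (set_pmf (sample_kernel b t m a))"
  unfolding sample_kernel_def
  by (auto intro!: finite_set_iter_pmf finite_walk_kernel finite_subset[OF set_target_pmf[OF t]])

lemma sample_mean:
  "measure_pmf.expectation (sample_kernel b t m a) (\<lambda>x. x)
     = a + (\<Sum>i<n. t $ i * (\<Sum>l<m. iterate b l i)) / lp_norm 1 t"
proof -
  let ?s = "\<lambda>i. if 0 < t $ i then 1 else - 1 :: real"
  have p: "0 < lp_norm 1 t" by (rule lp_norm_1_pos[OF t])
  have "measure_pmf.expectation (sample_kernel b t m a) (\<lambda>x. x) = (\<Sum>i<n. pmf (target_pmf t) i *\<^sub>R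
      measure_pmf.expectation (map_pmf (\<lambda>a. snd (snd a)) (iter_pmf (walk_kernel b) m (i, ?s i, a))) (\<lambda>x. x))"
    unfolding sample_kernel_def
    by (intro pmf_expectation_bind set_target_pmf[OF t]) (auto intro!: finite_set_iter_pmf finite_walk_kernel)
  also have "\<dots> = (\<Sum>i<n. (\<bar>t $ i\<bar> * a + t $ i * (\<Sum>l<m. iterate b l i)) / lp_norm 1 t)"
    by (intro sum.cong) (auto simp: pmf_target[OF t] walk_mean algebra_simps add_divide_distrib)
  also have "\<dots> = (\<Sum>i<n. \<bar>t $ i\<bar>) * a / lp_norm 1 t + (\<Sum>i<n. t $ i * (\<Sum>l<m. iterate b l i)) / lp_norm 1 t"
    by (simp add: sum.distrib add_divide_distrib sum_divide_distrib sum_distrib_right)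
  also have "(\<Sum>i<n. \<bar>t $ i\<bar>) * a / lp_norm 1 t = a" using p t(1) by (simp add: lp_norm_1)
  finally show ?thesis .
qed

lemma sample_bound:
  assumes "x \<in> set_pmf (sample_kernel b t m a)"
  shows "\<bar>x - a\<bar> \<le> real m * lp_norm \<infinity> (D_pow M (-1) *\<^sub>v b)"
proof -
  from assms obtain i c where i: "i \<in> set_pmf (target_pmf t)"
    "c \<in> set_pmf (iter_pmf (walk_kernel b) m (i, if 0 < t $ i then 1 else -1, a))" "x = snd (snd c)"
    by (auto simp: sample_kernel_def)
  have "i < n" using i(1) set_target_pmf[OF t] by auto
  from walk_bound[OF b(1) this i(2)] show ?thesis unfolding i(3) by (simp split: if_splits)
qed

lemma estimator_accuracy:
  assumes "b \<in> mat_range M" "0 < \<gamma>" "\<gamma> \<le> gamma_max M" and \<epsilon>: "0 < \<epsilon>"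
    and E: "E = \<epsilon> * lp_norm \<infinity> (D_pow M (-1) *\<^sub>v b)"
    and "log_arg M b t \<gamma> E \<le> U" "4 / \<gamma> * ln (U + 3) \<le> real m"
    and N: "N = 0 \<and> lp_norm 1 t * real m \<le> \<epsilon> \<or> 0 < N \<and> (2 * lp_norm 1 t * real m / \<epsilon>)\<^sup>2 \<le> real N"
  shows "3 / 4 \<le> measure (measure_pmf (iter_pmf (sample_kernel b t m) N 0))
    {x. \<bar>x / real N * lp_norm 1 t / 2 - scalar_prod t (x_star M b)\<bar> \<le> E}"
proof -
  let ?B = "lp_norm \<infinity> (D_pow M (-1) *\<^sub>v b)"
  let ?t1 = "lp_norm 1 t"
  define q where "q = (\<Sum>i<n. t $ i * (\<Sum>l<m. iterate b l i))"
  have B: "0 < ?B" by (rule max_norm_pos[OF b])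
  have t1: "0 < ?t1" by (rule lp_norm_1_pos[OF t])
  have E0: "0 < E" using B \<epsilon> E by simp
  have trunc: "\<bar>scalar_prod t (x_star M b) - q / 2\<bar> \<le> E / 2"
    unfolding q_def using assms b t E0 by (intro truncation_error) auto
  from N show ?thesis
  proof
    \<comment> \<open>Here \<open>x / real N\<close> is a division by zero, so the estimate is 0.
      The truncated value \<open>q / 2\<close> is at most \<open>E / 2\<close> in absolute value,
      and the truncation error adds at most as much.\<close>
    assume N: "N = 0 \<and> ?t1 * real m \<le> \<epsilon>"
    have "\<bar>q\<bar> \<le> (\<Sum>i<n. \<bar>t $ i\<bar> * (real m * ?B))"
      unfolding q_def
    proof (rule order_trans[OF sum_abs], rule sum_mono)
      fix i assume "i \<in> {..<n}"
      then have "\<bar>\<Sum>l<m. iterate b l i\<bar> \<le> (\<Sum>l<m. ?B)"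
        using iterate_le[OF b(1)] by (intro order_trans[OF sum_abs] sum_mono) auto
      then show "\<bar>t $ i * (\<Sum>l<m. iterate b l i)\<bar> \<le> \<bar>t $ i\<bar> * (real m * ?B)"
        unfolding abs_mult by (intro mult_left_mono) auto
    qed
    also have "\<dots> = (?t1 * real m) * ?B" 
      unfolding sum_distrib_right[symmetric] using t(1) by (simp add: lp_norm_1)
    also have "\<dots> \<le> E" unfolding E using N B by (intro mult_right_mono) auto
    finally have "\<bar>scalar_prod t (x_star M b)\<bar> \<le> E" using trunc by linarith
    then show ?thesis using N by simp
  next
    assume "0 < N \<and> (2 * ?t1 * real m / \<epsilon>)\<^sup>2 \<le> real N"
    then have N: "0 < N" "(2 * ?t1 * real m / \<epsilon>)\<^sup>2 \<le> real N" by auto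
    define \<mu> where "\<mu> = q / ?t1"
    \<comment> \<open>A deviation \<open>\<delta>\<close> of the total moves the estimate by
      \<open>\<delta> * ?t1 / (2 * real N) = E / 2\<close>, the half of the accuracy left for
      sampling.\<close>
    define \<delta> where "\<delta> = real N * E / ?t1"
    let ?I = "iter_pmf (sample_kernel b t m) N 0"
    have \<delta>: "0 < \<delta>" using N E0 t1 by (simp add: \<delta>_def)
    have "measure_pmf.expectation ?I (\<lambda>x. (x - real N * \<mu>)\<^sup>2) \<le> (0 + real N * \<mu> - real N * \<mu>)\<^sup>2 + real N * (real m * ?B)\<^sup>2"
      by (rule iter_pmf_second_moment[OF finite_sample_kernel])
        (simp_all add: sample_mean sample_bound \<mu>_def q_def)
    also have "\<dots> \<le> \<delta>\<^sup>2 / 4"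
    proof -
      have "(2 * ?t1 * real m)\<^sup>2 \<le> real N * \<epsilon>\<^sup>2" using N(2) \<epsilon> by (simp add: power_divide field_simps)
      then have "real N * ?B\<^sup>2 * (2 * ?t1 * real m)\<^sup>2 \<le> real N * ?B\<^sup>2 * (real N * \<epsilon>\<^sup>2)"
        by (intro mult_left_mono) auto
      then show ?thesis using t1 by (simp add: \<delta>_def E power_divide power_mult_distrib field_simps power2_eq_square)
    qed
    finally have "3 / 4 \<le> measure (measure_pmf ?I) {x. \<bar>x - real N * \<mu>\<bar> \<le> \<delta>}"
      using \<delta> by (intro Markov_second_moment_pmf finite_set_iter_pmf finite_sample_kernel) auto
    also have "\<dots> \<le> measure (measure_pmf ?I) {x. \<bar>x / real N * ?t1 / 2 - scalar_prod t (x_star M b)\<bar> \<le> E}"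
    proof (rule measure_pmf.finite_measure_mono, safe)
      fix x assume x: "\<bar>x - real N * \<mu>\<bar> \<le> \<delta>"
      have "x / real N * ?t1 / 2 - q / 2 = (x - real N * \<mu>) * (?t1 / (2 * real N))"
        using N t1 by (simp add: \<mu>_def field_simps)
      then have "\<bar>x / real N * ?t1 / 2 - q / 2\<bar> = \<bar>x - real N * \<mu>\<bar> * (?t1 / (2 * real N))"
        using t1 by (simp add: abs_mult)
      also have "\<dots> \<le> \<delta> * (?t1 / (2 * real N))" using x t1 by (intro mult_right_mono) auto
      also have "\<dots> = E / 2" using N t1 by (simp add: \<delta>_def)
      finally have "\<bar>x / real N * ?t1 / 2 - q / 2\<bar> + \<bar>q / 2 - scalar_prod t (x_star M b)\<bar> \<le> E / 2 + E / 2"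
        using trunc by (intro add_mono) (simp_all add: abs_minus_commute)
      then show "\<bar>x / real N * ?t1 / 2 - scalar_prod t (x_star M b)\<bar> \<le> E"
        using abs_triangle_ineq[of "x / real N * ?t1 / 2 - q / 2" "q / 2 - scalar_prod t (x_star M b)"] by simp
    qed simp
    finally show ?thesis .
  qed
qed

end
end

section \<open>The program\<close>

text \<open>The index of \<open>R\<close> counts the remaining iterations: the guard holds while it
  is positive and fails at 0. As the kernel side has full mass, the coupling also carries almost
  sure termination.\<close>

lemma rel_spmf_while:
  assumes step: "\<And>k s a. R (Suc k) s a \<Longrightarrow> g s \<and> rel_spmf (R k) (body s) (spmf_of_pmf (K a))"
    and stop: "\<And>s a. R 0 s a \<Longrightarrow> \<not> g s"
  shows "R k s a \<Longrightarrow> rel_spmf (R 0) (while_spmf g body s) (spmf_of_pmf (iter_pmf K k a))"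
proof (induction k arbitrary: s a)
  case 0
  then show ?case using stop[OF 0] by (subst while_spmf.simps) simp
next
  case (Suc k)
  have "rel_spmf (R 0) (bind_spmf (body s) (while_spmf g body))
      (bind_spmf (spmf_of_pmf (K a)) (\<lambda>x. spmf_of_pmf (iter_pmf K k x)))"
    using step[OF Suc.prems] Suc.IH by (intro rel_spmf_bindI[of "R k"]) auto
  then show ?case using step[OF Suc.prems]
    by (subst while_spmf.simps) (simp add: spmf_of_pmf_bind)
qed

text \<open>Replaces rounding, which the machine does not offer: a real counter going up from 0 in
  unit steps stays below \<open>x\<close> for exactly \<open>nat \<lceil>x\<rceil>\<close>
  iterations.\<close>

lemma less_nat_ceiling_iff: "real j < x \<longleftrightarrow> j < nat \<lceil>x\<rceil>"
  by linarith

lemma machine_simps [simp]: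
  "nmem (tick c s) = nmem s" "rmem (tick c s) = rmem s" "clock (tick c s) = clock s + c"
  "nmem (setN a x s) = (nmem s)(a := x)" "rmem (setN a x s) = rmem s" "clock (setN a x s) = clock s"
  "nmem (setR a v s) = nmem s" "rmem (setR a v s) = (rmem s)(a := v)" "clock (setR a v s) = clock s"
  by (simp_all add: tick_def setN_def setR_def)

primrec block :: "instr list \<Rightarrow> prog" where
  "block [] = Skip"
| "block (i # is) = Seq (Do i) (block is)"

text \<open>Natural-number cell 1 holds the position of the walk. Real cells: 4 the walk length, 5 the number of
  walks, 6 the accumulated sum, 7 and 8 the counters of walks and steps, 9 the sign of the current
  walk, 12 and 13 the constants 0 and 1. Cells 6, 7 and 12 are never initialised, as they start as 0.

  With \<open>L = 4 ln (U + 3) / \<gamma>\<close> and \<open>R = 4 L \<parallel>t\<parallel>\<^sub>1 / \<epsilon>\<close>, cells 4 and 5 are set to \<open>L\<close> and \<open>2 R\<^sup>2 - 1\<close>. The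
  number \<open>\<lceil>2 R\<^sup>2 - 1\<rceil>\<close> of walks never exceeds \<open>2 R\<^sup>2\<close> and is at least \<open>R\<^sup>2\<close> unless there is no walk at
  all; then \<open>R\<^sup>2 \<le> 1/2\<close>, and the final division \<open>0 / 0\<close> yields the estimate 0.\<close>

definition walk_body :: prog where
  "walk_body = Seq (block [GetB 10 1, GetDiag 11 1, RDiv 10 10 11, RMul 10 10 9, RAdd 6 6 10])
     (Seq (Do (WalkStep 1 10 1)) (block [RMul 9 9 10, RAdd 8 8 13]))"

definition sample_body :: prog where
  "sample_body = Seq (Do (SampleT 1)) (Seq (Do (GetT 9 1))
     (Seq (If (RLess 12 9) (Do (RConst 9 1)) (Do (RConst 9 (-1))))
     (Seq (Do (RConst 8 0)) (Seq (While (RLess 8 4) walk_body) (Do (RAdd 7 7 13))))))"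

definition estimator :: prog where
  "estimator = Seq (block [RConst 13 1, RConst 5 3, RAdd 4 3 5, RLn 4 4, RConst 5 4, RMul 4 5 4, RDiv 4 4 1,
       RMul 5 5 4, RMul 5 5 2, RDiv 5 5 0, RMul 5 5 5, RAdd 5 5 5, RSub 5 5 13])
     (Seq (While (RLess 7 5) sample_body)
       (block [RDiv 0 6 7, RMul 0 0 2, RConst 1 2, RDiv 0 0 1]))"

section \<open>Correctness and cost of the program\<close>

context rdd_matrix
begin

text \<open>The last conjunct is a time budget: an iteration costs one guard test, seven simple
  instructions and a walk step of at most \<open>f\<close>, hence at most
  \<open>8 + f \<le> 9 * f\<close>. The cells fixed by \<open>\<rho>\<close> and \<open>q\<close>
  are those the inner loop leaves unchanged.\<close>

definition walk_rel :: "nat \<Rightarrow> nat \<Rightarrow> (nat \<Rightarrow> real) \<Rightarrow> real \<Rightarrow> nat \<Rightarrow> nat \<Rightarrow> machine \<Rightarrow> nat \<times> real \<times> real \<Rightarrow> bool" where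
  "walk_rel f m \<rho> q T k s a \<longleftrightarrow> fst a < n \<and> nmem s 1 = fst a \<and> rmem s 9 = fst (snd a) \<and> rmem s 6 = snd (snd a)
     \<and> k \<le> m \<and> rmem s 8 = real (m - k) \<and> (\<forall>c\<in>{2, 4, 5, 12, 13}. rmem s c = \<rho> c) \<and> rmem s 7 = q
     \<and> clock s + k * (9 * f) \<le> T"

text \<open>The 8 units outside the steps of a walk are the guard, \<open>SampleT\<close>,
  \<open>GetT\<close>, the sign test, two constants, the last test of the inner loop and the counter
  increment.\<close>

definition sample_rel :: "nat \<Rightarrow> nat \<Rightarrow> nat \<Rightarrow> (nat \<Rightarrow> real) \<Rightarrow> nat \<Rightarrow> nat \<Rightarrow> machine \<Rightarrow> real \<Rightarrow> bool" where
  "sample_rel f m N \<rho> T k s a \<longleftrightarrow> rmem s 6 = a \<and> k \<le> N \<and> rmem s 7 = real (N - k)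
     \<and> (\<forall>c\<in>{2, 4, 5, 12, 13}. rmem s c = \<rho> c) \<and> clock s + k * (8 + 9 * f * m) \<le> T"

context
  fixes b t :: "real Matrix.vec" and \<tau> :: "nat \<Rightarrow> nat" and f m N :: nat and \<rho> :: "nat \<Rightarrow> real"
  assumes b: "b \<in> carrier_vec n" and t: "t \<in> carrier_vec n" "t \<noteq> 0\<^sub>v n"
    and f: "\<And>i. i < n \<Longrightarrow> max 1 (\<tau> i) \<le> f" "1 \<le> f"
    and \<rho>: "\<rho> 12 = 0" "\<rho> 13 = 1" "nat \<lceil>\<rho> 4\<rceil> = m" "nat \<lceil>\<rho> 5\<rceil> = N"
begin

text \<open>Only \<open>WalkStep\<close> is random, so the body is a deterministic image of one draw
  from \<open>walk_step\<close>, and so is \<open>walk_kernel\<close>. On termination cell 1 keeps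
  the old position and the returned sign 0 clears the weight, matching the kernel.\<close>

lemma exec_walk_body:
  assumes R: "walk_rel f m \<rho> q T (Suc k) s a"
  shows "rel_spmf (walk_rel f m \<rho> q T k) (exec M b t \<tau> walk_body (tick 1 s)) (spmf_of_pmf (walk_kernel b a))"
proof -
  obtain i w z where a: "a = (i, w, z)" by (cases a)
  have i: "i < n" using R by (simp add: walk_rel_def a)
  have dims: "dim_row M = n" "dim_vec b = n" using M b by auto
  have m: "real (m - k) = real (m - Suc k) + 1" using R by (simp add: walk_rel_def)
  define post where "post = (\<lambda>s. tick 1 (setR 8 (rmem s 8 + rmem s 13) s)) \<circ> (\<lambda>s. tick 1 (setR 9 (rmem s 9 * rmem s 10) s))"
  define y where "y = tick 1 (setR 6 (z + b $ i / d i * w) (tick 1 (setR 10 (b $ i / d i * w) (tick 1 (setR 10 (b $ i / d i)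
     (tick 1 (setR 11 (d i) (tick 1 (setR 10 (b $ i) (tick 1 s))))))))))"
  define step where "step r = tick (max 1 (\<tau> i)) (case r of None \<Rightarrow> setR 10 0 y
       | Some j \<Rightarrow> setN 1 j (setR 10 (walk_sign M i j) y))" for r
  have "exec M b t \<tau> walk_body (tick 1 s) = spmf_of_pmf (map_pmf (\<lambda>r. post (step r)) (walk_step M i))"
  proof -
    have 1: "nmem s 1 = i" "rmem s 9 = w" "rmem s 6 = z" using R by (simp_all add: walk_rel_def a)
    have pre: "exec M b t \<tau> (block [GetB 10 1, GetDiag 11 1, RDiv 10 10 11, RMul 10 10 9, RAdd 6 6 10]) (tick 1 s)
        = return_spmf y"
      using 1 i by (simp add: y_def Let_def dims)
    have "nmem y 1 = i" using 1 by (simp add: y_def)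
    then have "exec M b t \<tau> (Do (WalkStep 1 10 1)) y = map_spmf step (spmf_of_pmf (walk_step M i))"
      unfolding exec.simps exec_instr.simps step_def by simp
    moreover have "exec M b t \<tau> (block [RMul 9 9 10, RAdd 8 8 13]) = (\<lambda>x. return_spmf (post x))"
      by (rule ext) (simp add: post_def)
    ultimately have "exec M b t \<tau> walk_body (tick 1 s) = bind_spmf (map_spmf step (spmf_of_pmf (walk_step M i)))
        (\<lambda>x. return_spmf (post x))"
      unfolding walk_body_def exec.simps pre return_bind_spmf by simp
    then show ?thesis by (simp add: bind_map_pmf bind_pmf_return_spmf pmf.map_comp o_def)
  qed
  \<comment> \<open>Both sides are images of the same draw, so the identity coupling
    suffices.\<close>
  moreover have "rel_pmf (walk_rel f m \<rho> q T k) (map_pmf (\<lambda>r. post (step r)) (walk_step M i)) (walk_kernel b a)"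
    unfolding a walk_kernel.simps pmf.rel_map
  proof (rule rel_pmf_reflI)
    fix r assume "r \<in> set_pmf (walk_step M i)"
    then have "r \<in> insert None (Some ` {..<n})" using walk_step_set by blast
    then show "walk_rel f m \<rho> q T k (post (step r)) (case r of None \<Rightarrow> (i, 0, z + b $ i / d i * w)
           | Some j \<Rightarrow> (j, w * walk_sign M i j, z + b $ i / d i * w))"
      using R f(1)[OF i] f(2) m \<rho> by (auto simp: walk_rel_def a post_def step_def y_def)
  qed
  ultimately show ?thesis by simp
qed

text \<open>The extra unit of time is the guard test that ends the loop.\<close>

lemma exec_walk:
  assumes "walk_rel f m \<rho> q T m s a"
  shows "rel_spmf (\<lambda>s c. rmem s 6 = snd (snd c) \<and> rmem s 7 = q \<and> (\<forall>c\<in>{2, 4, 5, 12, 13}. rmem s c = \<rho> c) \<and> clock s \<le> T + 1)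
    (exec M b t \<tau> (While (RLess 8 4) walk_body) s) (spmf_of_pmf (iter_pmf (walk_kernel b) m a))"
proof -
  have "rel_spmf (walk_rel f m \<rho> q T 0) (while_spmf (holds (RLess 8 4)) (\<lambda>s. exec M b t \<tau> walk_body (tick 1 s)) s)
      (spmf_of_pmf (iter_pmf (walk_kernel b) m a))"
  proof (rule rel_spmf_while[where R = "walk_rel f m \<rho> q T", OF _ _ assms])
    fix k s a assume R: "walk_rel f m \<rho> q T (Suc k) s a"
    then have "m - Suc k < nat \<lceil>\<rho> 4\<rceil>" by (simp add: walk_rel_def \<rho>)
    then have "holds (RLess 8 4) s" using R by (simp add: walk_rel_def flip: less_nat_ceiling_iff)
    then show "holds (RLess 8 4) s \<and> rel_spmf (walk_rel f m \<rho> q T k) (exec M b t \<tau> walk_body (tick 1 s)) (spmf_of_pmf (walk_kernel b a))"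
      using exec_walk_body[OF R] by simp
  next
    fix s a assume R: "walk_rel f m \<rho> q T 0 s a"
    have "\<not> m < nat \<lceil>\<rho> 4\<rceil>" by (simp add: \<rho>)
    then show "\<not> holds (RLess 8 4) s" using R by (simp add: walk_rel_def flip: less_nat_ceiling_iff)
  qed
  then show ?thesis
    unfolding exec.simps spmf_rel_map by (rule rel_spmf_mono) (auto simp: walk_rel_def)
qed

lemma exec_sample_body:
  assumes R: "sample_rel f m N \<rho> T (Suc k) s a"
  shows "rel_spmf (sample_rel f m N \<rho> T k) (exec M b t \<tau> sample_body (tick 1 s)) (spmf_of_pmf (sample_kernel b t m a))"
proof -
  let ?Q = "Seq (Do (GetT 9 1)) (Seq (If (RLess 12 9) (Do (RConst 9 1)) (Do (RConst 9 (-1))))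
     (Seq (Do (RConst 8 0)) (Seq (While (RLess 8 4) walk_body) (Do (RAdd 7 7 13)))))"
  have dims: "dim_vec t = n" using t by auto
  have N: "real (N - k) = real (N - Suc k) + 1" using R by (simp add: sample_rel_def)
  have "rel_spmf (sample_rel f m N \<rho> T k) (exec M b t \<tau> ?Q s') (spmf_of_pmf
      (map_pmf (\<lambda>a. snd (snd a)) (iter_pmf (walk_kernel b) m (i, if 0 < t $ i then 1 else -1, a))))"
    if "s' = tick 1 (setN 1 i (tick 1 s)) \<and> i < n" for s' i
  proof -
    have i: "i < n" and s': "s' = tick 1 (setN 1 i (tick 1 s))" using that by auto
    let ?w = "if 0 < t $ i then 1 else - 1 :: real"
    define y where "y = tick 1 (setR 8 0 (tick 1 (setR 9 ?w (tick 1 (tick 1 (setR 9 (t $ i) s'))))))"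
    have y: "exec M b t \<tau> ?Q s' = bind_spmf (exec M b t \<tau> (While (RLess 8 4) walk_body) y) (exec M b t \<tau> (Do (RAdd 7 7 13)))"
      using i R by (simp add: y_def s' Let_def dims sample_rel_def \<rho> of_rat_minus del: exec.simps(5))
    \<comment> \<open>Six units have passed since \<open>s\<close>: the outer guard,
      \<open>SampleT\<close>, \<open>GetT\<close>, the sign test and two constants.\<close>
    have "walk_rel f m \<rho> (rmem s 7) (clock s + 6 + m * (9 * f)) m y (i, ?w, a)"
      using R i unfolding walk_rel_def sample_rel_def y_def s' by simp
    note walk = exec_walk[OF this]
    have last: "exec M b t \<tau> (Do (RAdd 7 7 13)) = (\<lambda>x. return_spmf (tick 1 (setR 7 (rmem x 7 + rmem x 13) x)))"
      by (rule ext) simp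
    show ?thesis
      unfolding y last map_spmf_of_pmf[symmetric] map_spmf_conv_bind_spmf[symmetric] spmf_rel_map
      by (rule rel_spmf_mono[OF walk]) (use R N \<rho> in \<open>auto simp: sample_rel_def algebra_simps\<close>)
  qed
  moreover have "rel_spmf (\<lambda>s' i. s' = tick 1 (setN 1 i (tick 1 s)) \<and> i < n)
      (exec M b t \<tau> (Do (SampleT 1)) (tick 1 s)) (spmf_of_pmf (target_pmf t))"
    using set_target_pmf[OF t] by (auto simp: pmf.rel_map intro!: rel_pmf_reflI)
  ultimately have "rel_spmf (sample_rel f m N \<rho> T k)
      (bind_spmf (exec M b t \<tau> (Do (SampleT 1)) (tick 1 s)) (exec M b t \<tau> ?Q))
      (bind_spmf (spmf_of_pmf (target_pmf t)) (\<lambda>i. spmf_of_pmf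
      (map_pmf (\<lambda>a. snd (snd a)) (iter_pmf (walk_kernel b) m (i, if 0 < t $ i then 1 else -1, a)))))"
    by (intro rel_spmf_bindI) blast+
  then show ?thesis
    unfolding sample_body_def sample_kernel_def spmf_of_pmf_bind bind_spmf_of_pmf
    by (simp only: exec.simps(3))
qed

lemma exec_samples:
  assumes "sample_rel f m N \<rho> T N s a"
  shows "rel_spmf (\<lambda>s c. rmem s 6 = c \<and> rmem s 7 = real N \<and> rmem s 2 = \<rho> 2 \<and> clock s \<le> T + 1)
    (exec M b t \<tau> (While (RLess 7 5) sample_body) s) (spmf_of_pmf (iter_pmf (sample_kernel b t m) N a))"
proof -
  have "rel_spmf (sample_rel f m N \<rho> T 0) (while_spmf (holds (RLess 7 5)) (\<lambda>s. exec M b t \<tau> sample_body (tick 1 s)) s)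
      (spmf_of_pmf (iter_pmf (sample_kernel b t m) N a))"
  proof (rule rel_spmf_while[where R = "sample_rel f m N \<rho> T", OF _ _ assms])
    fix k s a assume R: "sample_rel f m N \<rho> T (Suc k) s a"
    then have "N - Suc k < nat \<lceil>\<rho> 5\<rceil>" by (simp add: sample_rel_def \<rho>)
    then have "holds (RLess 7 5) s" using R by (simp add: sample_rel_def flip: less_nat_ceiling_iff)
    then show "holds (RLess 7 5) s \<and> rel_spmf (sample_rel f m N \<rho> T k) (exec M b t \<tau> sample_body (tick 1 s)) (spmf_of_pmf (sample_kernel b t m a))"
      using exec_sample_body[OF R] by simp
  next
    fix s a assume R: "sample_rel f m N \<rho> T 0 s a"
    have "\<not> N < nat \<lceil>\<rho> 5\<rceil>" by (simp add: \<rho>)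
    then show "\<not> holds (RLess 7 5) s" using R by (simp add: sample_rel_def flip: less_nat_ceiling_iff)
  qed
  then show ?thesis
    unfolding exec.simps spmf_rel_map by (rule rel_spmf_mono) (auto simp: sample_rel_def)
qed

end

text \<open>The 18 units are 13 initial instructions, the final test of the outer loop and 4 closing
  instructions.\<close>

lemma run_estimator:
  assumes b: "b \<in> carrier_vec n" and t: "t \<in> carrier_vec n" "t \<noteq> 0\<^sub>v n"
    and f: "\<And>i. i < n \<Longrightarrow> max 1 (\<tau> i) \<le> f" "1 \<le> f"
    and m: "m = nat \<lceil>4 * ln (U + 3) / \<gamma>\<rceil>"
    and N: "N = nat \<lceil>2 * (4 * (4 * ln (U + 3) / \<gamma>) * lp_norm 1 t / \<epsilon>)\<^sup>2 - 1\<rceil>"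
  shows "rel_spmf (\<lambda>s x. estimate s = x / real N * lp_norm 1 t / 2 \<and> clock s \<le> 18 + N * (8 + 9 * f * m))
    (run estimator M b t \<tau> \<epsilon> \<gamma> U) (spmf_of_pmf (iter_pmf (sample_kernel b t m) N 0))"
proof -
  define init where "init = block [RConst 13 1, RConst 5 3, RAdd 4 3 5, RLn 4 4, RConst 5 4, RMul 4 5 4, RDiv 4 4 1,
       RMul 5 5 4, RMul 5 5 2, RDiv 5 5 0, RMul 5 5 5, RAdd 5 5 5, RSub 5 5 13]"
  define fin where "fin = block [RDiv 0 6 7, RMul 0 0 2, RConst 1 2, RDiv 0 0 1]"
  let ?L = "4 * ln (U + 3) / \<gamma>"
  let ?R = "4 * ?L * lp_norm 1 t / \<epsilon>"
  let ?s = "initial n \<epsilon> \<gamma> (lp_norm 1 t) U"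
  have "\<exists>s. exec M b t \<tau> init ?s = return_spmf s \<and>
    rmem s 2 = lp_norm 1 t \<and> rmem s 4 = ?L \<and> rmem s 5 = 2 * ?R\<^sup>2 - 1 \<and> rmem s 6 = 0 \<and> rmem s 7 = 0 \<and>
    rmem s 12 = 0 \<and> rmem s 13 = 1 \<and> clock s = 13"
    by (simp add: init_def initial_def power2_eq_square mult_ac)
  then obtain s where s: "exec M b t \<tau> init ?s = return_spmf s" and s_val:
    "rmem s 2 = lp_norm 1 t" "rmem s 4 = ?L" "rmem s 5 = 2 * ?R\<^sup>2 - 1" "rmem s 6 = 0" "rmem s 7 = 0"
    "rmem s 12 = 0" "rmem s 13 = 1" "clock s = 13"
    by blast
  have "rel_spmf (\<lambda>s' c. rmem s' 6 = c \<and> rmem s' 7 = real N \<and> rmem s' 2 = rmem s 2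
        \<and> clock s' \<le> 13 + N * (8 + 9 * f * m) + 1)
      (exec M b t \<tau> (While (RLess 7 5) sample_body) s) (spmf_of_pmf (iter_pmf (sample_kernel b t m) N 0))"
  proof (rule exec_samples[OF b t f])
    show "nat \<lceil>rmem s 4\<rceil> = m" unfolding s_val m ..
    show "nat \<lceil>rmem s 5\<rceil> = N" unfolding s_val N ..
    show "sample_rel f m N (rmem s) (13 + N * (8 + 9 * f * m)) N s 0"
      by (simp add: sample_rel_def s_val)
  qed (simp_all add: s_val)
  then have "rel_spmf (\<lambda>s x. estimate s = x / real N * lp_norm 1 t / 2 \<and> clock s \<le> 18 + N * (8 + 9 * f * m))
      (bind_spmf (exec M b t \<tau> (While (RLess 7 5) sample_body) s) (exec M b t \<tau> fin))
      (bind_spmf (spmf_of_pmf (iter_pmf (sample_kernel b t m) N 0)) return_spmf)"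
    by (rule rel_spmf_bindI) (simp add: fin_def estimate_def s_val)
  then show ?thesis
    unfolding run_def estimator_def init_def[symmetric] fin_def[symmetric]
    using M by (simp add: s del: exec.simps(5) bind_spmf_of_pmf)
qed

end

section \<open>Running time\<close>

text \<open>Relates the logarithm that the program computes to the one in the running time:
  \<open>U + 3\<close> is at most \<open>4 * max 1 U\<close>, and
  \<open>ln 4 \<le> 2\<close>.\<close>

lemma ln_add_3_le:
  assumes "0 < (U :: real)"
  shows "ln (U + 3) \<le> 3 * max 1 (ln U)"
proof -
  have "ln (U + 3) \<le> ln (4 * max 1 U)" using assms by simp
  also have "\<dots> = ln 4 + ln (max 1 U)" using assms by (simp add: ln_mult)
  also have "ln (max 1 U) \<le> max 1 (ln U)" by (simp add: max_def)
  also have "ln (4 :: real) \<le> 2"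
    using ln_realpow[of 2 2] ln_le_minus_one[of "2 :: real"] by simp
  finally show ?thesis by linarith
qed

text \<open>The shift by 3 works because \<open>exp 1 \<le> 3\<close>; it keeps the walk length away
  from 0 even for small \<open>U\<close>.\<close>

lemma one_le_ln_add_3:
  assumes "0 \<le> (x :: real)"
  shows "1 \<le> ln (x + 3)"
  using assms exp_le by (subst ln_ge_iff) linarith+

context rdd_matrix
begin

text \<open>The norm of \<open>b\<close> cancels against the one in \<open>E\<close>. With
  \<open>A = K n^K\<close> the rest is at most \<open>A^3 n^2 / (\<gamma> \<epsilon>)\<close>, whose
  logarithm is linear in \<open>\<Lambda>\<close>.\<close>

lemma ln_log_arg_le:
  fixes K :: nat
  assumes mag: "\<And>i j. i < n \<Longrightarrow> j < n \<Longrightarrow> poly_magnitude K n (M $$ (i, j))"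
      "\<And>i. i < n \<Longrightarrow> poly_magnitude K n (t $ i)"
    and b: "b \<in> carrier_vec n" "b \<noteq> 0\<^sub>v n" and t: "t \<in> carrier_vec n" "t \<noteq> 0\<^sub>v n"
    and \<gamma>: "0 < \<gamma>" and \<epsilon>: "0 < \<epsilon>" and E: "E = \<epsilon> * lp_norm \<infinity> (D_pow M (-1) *\<^sub>v b)"
  shows "max 1 (ln (log_arg M b t \<gamma> E)) \<le> (6 * real K + 4) * ln (2 + real n + 1 / \<gamma> + 1 / \<epsilon>)"
proof -
  define \<Lambda> where "\<Lambda> = ln (2 + real n + 1 / \<gamma> + 1 / \<epsilon>)"
  define A where "A = real K * real n ^ K"
  let ?B = "lp_norm \<infinity> (D_pow M (-1) *\<^sub>v b)"
  let ?T = "lp_norm \<infinity> (D_pow M (-1) *\<^sub>v t)"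
  have B: "0 < ?B" by (rule max_norm_pos[OF b])
  have d: "1 / A \<le> d i" "d i \<le> A" if "i < n" for i
    using mag(1)[OF that that] d_pos[OF that] by (auto simp: poly_magnitude_def A_def)
  have n: "1 \<le> real n" using n_pos by simp
  \<comment> \<open>For \<open>K = 0\<close> the upper bound \<open>A\<close> would be 0,
    contradicting the positive diagonal.\<close>
  have K: "1 \<le> K"
  proof (rule ccontr)
    assume "\<not> 1 \<le> K"
    then have "A = 0" by (simp add: A_def)
    then show False using d(2)[OF n_pos] d_pos[OF n_pos] by simp
  qed
  have A: "1 \<le> A"
    unfolding A_def using K n mult_mono[of 1 "real K" 1 "real n ^ K"] by simp
  have \<Lambda>1: "1 \<le> \<Lambda>"
  proof -
    have "1 \<le> ln (real n - 1 + 1 / \<gamma> + 1 / \<epsilon> + 3)"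
      using n \<gamma> \<epsilon> by (intro one_le_ln_add_3) (simp add: add_nonneg_nonneg)
    then show ?thesis by (simp add: \<Lambda>_def algebra_simps)
  qed
  have dm: "d_max M \<le> A" using d(2) by (metis d_max_attained)
  have T: "?T \<le> A * A"
  proof -
    obtain i where i: "i < n" "?T = \<bar>t $ i / d i\<bar>" by (rule max_norm_attained[OF t(1)])
    have "\<bar>t $ i\<bar> \<le> A" using mag(2)[OF i(1)] A by (auto simp: poly_magnitude_def A_def)
    moreover have "1 / d i \<le> A" using d(1)[OF i(1)] d_pos[OF i(1)] A by (simp add: field_simps)
    ultimately have "\<bar>t $ i\<bar> * (1 / d i) \<le> A * A"
      using d_pos[OF i(1)] A by (intro mult_mono) auto
    then show ?thesis unfolding i(2) using d_pos[OF i(1)] by simp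
  qed
  have l0: "real (l0_norm v) \<le> real n" if "v \<in> carrier_vec n" for v
  proof -
    have "l0_norm v \<le> card {..<n}" unfolding l0_norm_def using that by (intro card_mono) auto
    then show ?thesis by simp
  qed
  have "log_arg M b t \<gamma> E = 1 / \<gamma> * (1 / \<epsilon>) * (d_max M * real (l0_norm t) * ?T * real (l0_norm b))"
    using B by (simp add: log_arg_def E)
  also have "\<dots> \<le> 1 / \<gamma> * (1 / \<epsilon>) * (A * real n * (A * A) * real n)"
    using dm T l0[OF t(1)] l0[OF b(1)] A n \<gamma> \<epsilon> d_max_pos max_norm_pos[OF t]
    by (intro mult_left_mono mult_mono) auto
  finally have "ln (log_arg M b t \<gamma> E) \<le> ln (1 / \<gamma> * (1 / \<epsilon>) * (A * real n * (A * A) * real n))"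
    using log_arg_pos[OF b(1) t(1) b(2) t(2) \<gamma>, of E] \<epsilon> B E by (intro ln_mono) simp_all
  also have "\<dots> = ln (1 / \<gamma>) + ln (1 / \<epsilon>) + 3 * ln A + 2 * ln (real n)"
    using A n \<gamma> \<epsilon> by (simp add: ln_mult ln_div)
  also have "ln A = ln (real K) + real K * ln (real n)"
    unfolding A_def using K n by (simp add: ln_mult ln_realpow)
  finally have 1: "ln (log_arg M b t \<gamma> E)
      \<le> ln (1 / \<gamma>) + ln (1 / \<epsilon>) + 3 * (ln (real K) + real K * ln (real n)) + 2 * ln (real n)" .
  have "ln (1 / \<gamma>) \<le> \<Lambda>" "ln (1 / \<epsilon>) \<le> \<Lambda>" "ln (real n) \<le> \<Lambda>"
    unfolding \<Lambda>_def using \<gamma> \<epsilon> n by (auto intro!: ln_mono simp: add_nonneg_nonneg add_pos_nonneg)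
  moreover from this have "real K * ln (real n) \<le> real K * \<Lambda>" by (intro mult_left_mono) auto
  moreover have "ln (real K) \<le> real K * \<Lambda>"
    using ln_le_minus_one[of "real K"] K mult_left_mono[OF \<Lambda>1, of "real K"] by linarith
  \<comment> \<open>Each of the three factors \<open>A\<close> costs
    \<open>2 * real K * \<Lambda>\<close>; \<open>1 / \<gamma>\<close>,
    \<open>1 / \<epsilon>\<close> and the two factors \<open>n\<close> account for the 4.\<close>
  ultimately have "ln (log_arg M b t \<gamma> E) \<le> \<Lambda> + \<Lambda> + 3 * (real K * \<Lambda> + real K * \<Lambda>) + 2 * \<Lambda>"
    by (intro order_trans[OF 1] add_mono mult_left_mono) auto
  also have "\<dots> = (6 * real K + 4) * \<Lambda>" by (simp add: algebra_simps)
  moreover have "1 \<le> (6 * real K + 4) * \<Lambda>"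
    using \<Lambda>1 mult_mono[of 1 "6 * real K + 4" 1 \<Lambda>] by simp
  ultimately show ?thesis by (simp add: \<Lambda>_def)
qed

end

section \<open>Accuracy and running time combined\<close>

theorem theorem1p4:
  shows "\<exists>(P :: prog) (a :: nat). \<forall>(K :: nat) (\<kappa> :: real). \<exists>C :: real.
    \<forall>(n :: nat) (M :: real mat) (b :: real Matrix.vec) (t :: real Matrix.vec)
     (\<tau> :: nat \<Rightarrow> nat) (\<epsilon> :: real) (\<gamma> :: real) (E :: real) (U :: real).
      M \<in> carrier_mat n n \<and> b \<in> carrier_vec n \<and> t \<in> carrier_vec n \<and>
      b \<in> mat_range M \<and> b \<noteq> 0\<^sub>v n \<and> t \<noteq> 0\<^sub>v n \<and>
      (\<forall>i<n. \<forall>j<n. poly_magnitude K n (M $$ (i, j))) \<and>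
      (\<forall>i<n. poly_magnitude K n (b $ i)) \<and>
      (\<forall>i<n. poly_magnitude K n (t $ i)) \<and>
      RDD M \<and>
      0 < \<epsilon> \<and> 0 < \<gamma> \<and> \<gamma> \<le> gamma_max M \<and>
      (\<forall>i<n. 1 \<le> \<tau> i) \<and>
      E = \<epsilon> * lp_norm \<infinity> (D_pow M (-1) *\<^sub>v b) \<and>
      log_arg M b t \<gamma> E \<le> U \<and>
      max 1 (ln U) \<le> \<kappa> * max 1 (ln (log_arg M b t \<gamma> E))
      \<longrightarrow>
      lossless_spmf (run P M b t \<tau> \<epsilon> \<gamma> U) \<and>
      measure (measure_spmf (run P M b t \<tau> \<epsilon> \<gamma> U))
        {s. \<bar>estimate s - scalar_prod t (x_star M b)\<bar> \<le> E} \<ge> 3 / 4 \<and>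
      (\<forall>s \<in> set_spmf (run P M b t \<tau> \<epsilon> \<gamma> U).
        real (clock s) \<le>
          C * max 1 (real (f_row n \<tau>) * (lp_norm 1 t)\<^sup>2 * (trunc_L M b t \<gamma> E) ^ 3 / \<epsilon>\<^sup>2) \<and>
        real (clock s) \<le>
          C * max 1 (real (f_row n \<tau>) * (lp_norm 1 t)\<^sup>2 / (\<gamma> ^ 3 * \<epsilon>\<^sup>2))
            * ln (2 + real n + 1 / \<gamma> + 1 / \<epsilon>) ^ a)"
proof (rule exI[of _ estimator], rule exI[of _ 3], intro allI)
  fix K :: nat and \<kappa> :: real
  \<comment> \<open>Here \<open>1088 = 2 * 16 * 17 * 2\<close> collects the constants of
    \<open>2 * R\<^sup>2\<close>, the cost per step and the rounding of \<open>m\<close>, and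
    \<open>12 * \<bar>\<kappa>\<bar>\<close> bounds \<open>L\<close> relative to
    \<open>trunc_L\<close>. The absolute value is taken because \<open>\<kappa>\<close> is fixed
    before the hypothesis that makes it nonnegative.\<close>
  define C1 where "C1 = 18 + 1088 * (12 * \<bar>\<kappa>\<bar>) ^ 3"
  define c where "c = 6 * real K + 4"
  have C1: "0 \<le> C1" by (simp add: C1_def)
  have c: "1 \<le> c ^ 3" by (simp add: c_def)
  show "\<exists>C. \<forall>n M b t \<tau> \<epsilon> \<gamma> E U.
      M \<in> carrier_mat n n \<and> b \<in> carrier_vec n \<and> t \<in> carrier_vec n \<and>
      b \<in> mat_range M \<and> b \<noteq> 0\<^sub>v n \<and> t \<noteq> 0\<^sub>v n \<and>
      (\<forall>i<n. \<forall>j<n. poly_magnitude K n (M $$ (i, j))) \<and>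
      (\<forall>i<n. poly_magnitude K n (b $ i)) \<and>
      (\<forall>i<n. poly_magnitude K n (t $ i)) \<and>
      RDD M \<and>
      0 < \<epsilon> \<and> 0 < \<gamma> \<and> \<gamma> \<le> gamma_max M \<and>
      (\<forall>i<n. 1 \<le> \<tau> i) \<and>
      E = \<epsilon> * lp_norm \<infinity> (D_pow M (-1) *\<^sub>v b) \<and>
      log_arg M b t \<gamma> E \<le> U \<and>
      max 1 (ln U) \<le> \<kappa> * max 1 (ln (log_arg M b t \<gamma> E))
      \<longrightarrow>
      lossless_spmf (run estimator M b t \<tau> \<epsilon> \<gamma> U) \<and>
      measure (measure_spmf (run estimator M b t \<tau> \<epsilon> \<gamma> U))
        {s. \<bar>estimate s - scalar_prod t (x_star M b)\<bar> \<le> E} \<ge> 3 / 4 \<and>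
      (\<forall>s \<in> set_spmf (run estimator M b t \<tau> \<epsilon> \<gamma> U).
        real (clock s) \<le>
          C * max 1 (real (f_row n \<tau>) * (lp_norm 1 t)\<^sup>2 * (trunc_L M b t \<gamma> E) ^ 3 / \<epsilon>\<^sup>2) \<and>
        real (clock s) \<le>
          C * max 1 (real (f_row n \<tau>) * (lp_norm 1 t)\<^sup>2 / (\<gamma> ^ 3 * \<epsilon>\<^sup>2))
            * ln (2 + real n + 1 / \<gamma> + 1 / \<epsilon>) ^ 3)"
  \<comment> \<open>\<open>C1\<close> alone serves the first time bound; the factor
    \<open>c ^ 3\<close>, at least 1, pays for replacing the cubed logarithm by
    \<open>\<Lambda> ^ 3\<close> in the second.\<close>
  proof (rule exI[of _ "C1 * c ^ 3"], intro allI impI, elim conjE)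
    fix n :: nat and M :: "real mat" and b t :: "real Matrix.vec" and \<tau> :: "nat \<Rightarrow> nat" and \<epsilon> \<gamma> E U :: real
    assume M: "M \<in> carrier_mat n n" and b: "b \<in> carrier_vec n" and t: "t \<in> carrier_vec n"
      and b_range: "b \<in> mat_range M" and b0: "b \<noteq> 0\<^sub>v n" and t0: "t \<noteq> 0\<^sub>v n"
      and magM: "\<forall>i<n. \<forall>j<n. poly_magnitude K n (M $$ (i, j))"
      and magt: "\<forall>i<n. poly_magnitude K n (t $ i)"
      and rdd: "RDD M"
      and \<epsilon>: "0 < \<epsilon>" and \<gamma>: "0 < \<gamma>" "\<gamma> \<le> gamma_max M"
      and \<tau>: "\<forall>i<n. 1 \<le> \<tau> i"
      and E: "E = \<epsilon> * lp_norm \<infinity> (D_pow M (-1) *\<^sub>v b)"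
      and U: "log_arg M b t \<gamma> E \<le> U"
      and \<kappa>: "max 1 (ln U) \<le> \<kappa> * max 1 (ln (log_arg M b t \<gamma> E))"
    have "0 < n" using b b0 by (cases n) auto
    then interpret rdd_matrix n M using M rdd by unfold_locales
    define f where "f = f_row n \<tau>"
    define t1 where "t1 = lp_norm 1 t"
    define \<Lambda> where "\<Lambda> = ln (2 + real n + 1 / \<gamma> + 1 / \<epsilon>)"
    define l where "l = max 1 (ln (log_arg M b t \<gamma> E))"
    define L where "L = 4 * ln (U + 3) / \<gamma>"
    define R where "R = 4 * L * t1 / \<epsilon>"
    define m where "m = nat \<lceil>L\<rceil>"
    define N where "N = nat \<lceil>2 * R\<^sup>2 - 1\<rceil>"
    have E0: "0 < E" using E \<epsilon> max_norm_pos[OF b b0] by simp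
    have U0: "0 < U" using log_arg_pos[OF b t b0 t0 \<gamma>(1) E0] U by linarith
    have t1: "0 < t1" unfolding t1_def by (rule lp_norm_1_pos[OF t t0])
    have \<tau>f: "\<tau> i \<le> f" if "i < n" for i
      unfolding f_def f_row_def using that by (intro Max_ge) auto
    have f1: "1 \<le> f" using \<tau> \<tau>f n_pos by (metis order_trans)
    have f: "max 1 (\<tau> i) \<le> f" if "i < n" for i using \<tau>f[OF that] f1 by simp
    \<comment> \<open>As \<open>\<gamma> < 2\<close> and \<open>ln (U + 3) \<ge> 1\<close>, rounding
      \<open>L\<close> up to \<open>m\<close> at most doubles it. The constant 4 in
      \<open>R\<close>, instead of 2, compensates for this.\<close>
    have L2: "2 \<le> L"
    proof -
      have "\<gamma> * 2 \<le> 4 * ln (U + 3)"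
        using gamma_less_2[OF b_range b0 \<gamma>] one_le_ln_add_3[of U] U0 by linarith
      then show ?thesis using \<gamma> by (simp add: L_def field_simps)
    qed
    have m: "L \<le> real m" "real m \<le> 2 * L" "1 \<le> m" using L2 unfolding m_def by linarith+
    have mR: "2 * t1 * real m / \<epsilon> \<le> R"
    proof -
      have "2 * t1 * real m \<le> 2 * t1 * (2 * L)" using m t1 by (intro mult_left_mono) auto
      then show ?thesis using \<epsilon> by (simp add: R_def divide_right_mono mult_ac)
    qed
    have N_ub: "real N \<le> 2 * R\<^sup>2"
    proof (cases "2 * R\<^sup>2 - 1 \<le> 0")
      case True
      then have "N = 0" by (simp add: N_def)
      then show ?thesis by simp
    next
      case False
      then show ?thesis unfolding N_def by linarith
    qed
    have rel: "rel_spmf (\<lambda>s x. estimate s = x / real N * lp_norm 1 t / 2 \<and> clock s \<le> 18 + N * (8 + 9 * f * m))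
        (run estimator M b t \<tau> \<epsilon> \<gamma> U) (spmf_of_pmf (iter_pmf (sample_kernel b t m) N 0))"
      by (rule run_estimator[OF b t t0 f f1]) (simp_all only: m_def N_def R_def L_def t1_def)
    \<comment> \<open>A coupling preserves total mass, and the other side is a proper
      distribution.\<close>
    have loss: "lossless_spmf (run estimator M b t \<tau> \<epsilon> \<gamma> U)"
      using rel_spmf_weightD[OF rel] by (simp add: lossless_spmf_def)
    have map_est: "map_spmf estimate (run estimator M b t \<tau> \<epsilon> \<gamma> U)
        = spmf_of_pmf (map_pmf (\<lambda>x. x / real N * lp_norm 1 t / 2) (iter_pmf (sample_kernel b t m) N 0))"
      unfolding spmf_rel_eq[symmetric] map_spmf_of_pmf[symmetric] spmf_rel_map
      by (rule rel_spmf_mono[OF rel]) simp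
    have "measure (measure_spmf (run estimator M b t \<tau> \<epsilon> \<gamma> U))
          {s. \<bar>estimate s - scalar_prod t (x_star M b)\<bar> \<le> E}
        = measure (measure_spmf (map_spmf estimate (run estimator M b t \<tau> \<epsilon> \<gamma> U)))
          {x. \<bar>x - scalar_prod t (x_star M b)\<bar> \<le> E}"
      by (simp add: measure_map_spmf vimage_def)
    also have "\<dots> = measure (measure_pmf (iter_pmf (sample_kernel b t m) N 0))
          {x. \<bar>x / real N * lp_norm 1 t / 2 - scalar_prod t (x_star M b)\<bar> \<le> E}"
      unfolding map_est by (simp add: vimage_def)
    also have "\<dots> \<ge> 3 / 4"
    proof (rule estimator_accuracy[OF b b0 t t0 b_range \<gamma> \<epsilon> E U])
      show "4 / \<gamma> * ln (U + 3) \<le> real m" using m(1) by (simp add: L_def)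
      show "N = 0 \<and> lp_norm 1 t * real m \<le> \<epsilon> \<or> 0 < N \<and> (2 * lp_norm 1 t * real m / \<epsilon>)\<^sup>2 \<le> real N"
      proof (cases "N = 0")
        case True
        then have "R\<^sup>2 \<le> 1\<^sup>2" unfolding N_def by simp
        then have "R \<le> 1" by (rule power2_le_imp_le) simp
        then have "2 * t1 * real m / \<epsilon> \<le> 1" using mR by linarith
        then have "2 * (t1 * real m) \<le> \<epsilon>" using \<epsilon> by (simp add: field_simps)
        moreover have "0 \<le> t1 * real m" using t1 by simp
        ultimately show ?thesis using True unfolding t1_def by linarith
      next
        case False
        have "(2 * t1 * real m / \<epsilon>)\<^sup>2 \<le> R\<^sup>2" using mR t1 \<epsilon> by (intro power_mono) auto
        also have "\<dots> \<le> real N"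
        \<comment> \<open>One walk is enough if \<open>R\<^sup>2 \<le> 1\<close>; otherwise
          \<open>2 * R\<^sup>2 - 1 \<ge> R\<^sup>2\<close>.\<close>
        proof (cases "R\<^sup>2 \<le> 1")
          case True
          then show ?thesis using False by linarith
        next
          case False
          then show ?thesis unfolding N_def by linarith
        qed
        finally show ?thesis using False by (simp add: t1_def)
      qed
    qed
    finally have prob: "3 / 4 \<le> measure (measure_spmf (run estimator M b t \<tau> \<epsilon> \<gamma> U))
          {s. \<bar>estimate s - scalar_prod t (x_star M b)\<bar> \<le> E}" .
    define X1 where "X1 = real f * t1\<^sup>2 * trunc_L M b t \<gamma> E ^ 3 / \<epsilon>\<^sup>2"
    define X2 where "X2 = real f * t1\<^sup>2 / (\<gamma> ^ 3 * \<epsilon>\<^sup>2)"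
    have l1: "1 \<le> l" by (simp add: l_def)
    have \<kappa>0: "0 \<le> \<kappa>"
    proof (rule ccontr)
      assume "\<not> 0 \<le> \<kappa>"
      then have "\<kappa> * l \<le> 0" using l1 by (simp add: mult_nonpos_nonneg)
      then show False using \<kappa> unfolding l_def by linarith
    qed
    have trunc: "trunc_L M b t \<gamma> E = l / \<gamma>" by (simp add: trunc_L_def l_def)
    have X1_eq: "X1 = X2 * l ^ 3" by (simp add: X1_def X2_def trunc power_divide)
    have time1: "real (clock s) \<le> C1 * max 1 X1" if s: "s \<in> set_spmf (run estimator M b t \<tau> \<epsilon> \<gamma> U)" for s
    proof -
      have L_le: "L \<le> 12 * \<kappa> * (l / \<gamma>)"
      proof -
        have "ln (U + 3) \<le> 3 * (\<kappa> * l)" using ln_add_3_le[OF U0] \<kappa> unfolding l_def by linarith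
        then have "4 * ln (U + 3) / \<gamma> \<le> 4 * (3 * (\<kappa> * l)) / \<gamma>"
          using \<gamma> by (intro divide_right_mono mult_left_mono) auto
        then show ?thesis by (simp add: L_def mult_ac)
      qed
      have "clock s \<le> 18 + N * (8 + 9 * f * m)"
        using rel s by (auto elim!: rel_spmfE)
      \<comment> \<open>Here \<open>f * m \<ge> 1\<close> lets the fixed cost 8 per walk be charged
        to its steps, giving \<open>17 = 8 + 9\<close>.\<close>
      also have "\<dots> \<le> 18 + N * (17 * f * m)"
        using f1 m(3) mult_le_mono[of 1 f 1 m] by (intro add_left_mono mult_left_mono) auto
      finally have "real (clock s) \<le> real (18 + N * (17 * f * m))" by (rule of_nat_mono)
      also have "\<dots> = 18 + real N * (17 * real f * real m)" by simp
      also have "\<dots> \<le> 18 + 2 * R\<^sup>2 * (17 * real f * (2 * L))"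
        using N_ub m by (intro add_left_mono mult_mono) auto
      also have "\<dots> = 18 + 1088 * (real f * t1\<^sup>2 / \<epsilon>\<^sup>2) * L ^ 3"
        by (simp add: R_def power2_eq_square power3_eq_cube)
      also have "\<dots> \<le> 18 + 1088 * (real f * t1\<^sup>2 / \<epsilon>\<^sup>2) * (12 * \<kappa> * (l / \<gamma>)) ^ 3"
        using L_le L2 by (intro add_left_mono mult_left_mono power_mono) auto
      also have "\<dots> = 18 + 1088 * (12 * \<bar>\<kappa>\<bar>) ^ 3 * X1"
        using \<kappa>0 by (simp add: X1_def trunc power_mult_distrib power_divide mult_ac)
      also have "\<dots> \<le> 18 * max 1 X1 + 1088 * (12 * \<bar>\<kappa>\<bar>) ^ 3 * max 1 X1"
        by (intro add_mono mult_left_mono) auto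
      also have "\<dots> = C1 * max 1 X1" by (simp add: C1_def algebra_simps)
      finally show ?thesis .
    qed
    have \<Lambda>: "l \<le> c * \<Lambda>"
      unfolding l_def c_def \<Lambda>_def using magM magt by (intro ln_log_arg_le b b0 t t0 \<gamma> \<epsilon> E) auto
    have le1: "C1 * max 1 X1 \<le> C1 * c ^ 3 * max 1 X1"
      using mult_mono[of C1 "C1 * c ^ 3" "max 1 X1" "max 1 X1"] C1 c mult_left_mono[OF c C1] by simp
    have le2: "C1 * max 1 X1 \<le> C1 * c ^ 3 * max 1 X2 * \<Lambda> ^ 3"
    proof -
      have l3: "l ^ 3 \<le> c ^ 3 * \<Lambda> ^ 3" using power_mono[OF \<Lambda>, of 3] l1 by (simp add: power_mult_distrib)
      have "max 1 X1 \<le> max 1 X2 * l ^ 3"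
      proof (rule max.boundedI)
        have "1 \<le> l ^ 3" using l1 by (rule one_le_power)
        then show "1 \<le> max 1 X2 * l ^ 3" using mult_mono[of 1 "max 1 X2" 1 "l ^ 3"] by simp
        show "X1 \<le> max 1 X2 * l ^ 3" unfolding X1_eq using l1 by (intro mult_right_mono) auto
      qed
      also have "\<dots> \<le> max 1 X2 * (c ^ 3 * \<Lambda> ^ 3)" using l3 by (intro mult_left_mono) auto
      finally have "C1 * max 1 X1 \<le> C1 * (max 1 X2 * (c ^ 3 * \<Lambda> ^ 3))" using C1 by (rule mult_left_mono)
      then show ?thesis by (simp add: mult_ac)
    qed
    show "lossless_spmf (run estimator M b t \<tau> \<epsilon> \<gamma> U) \<and>
      measure (measure_spmf (run estimator M b t \<tau> \<epsilon> \<gamma> U))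
        {s. \<bar>estimate s - scalar_prod t (x_star M b)\<bar> \<le> E} \<ge> 3 / 4 \<and>
      (\<forall>s \<in> set_spmf (run estimator M b t \<tau> \<epsilon> \<gamma> U).
        real (clock s) \<le>
          C1 * c ^ 3 * max 1 (real (f_row n \<tau>) * (lp_norm 1 t)\<^sup>2 * (trunc_L M b t \<gamma> E) ^ 3 / \<epsilon>\<^sup>2) \<and>
        real (clock s) \<le>
          C1 * c ^ 3 * max 1 (real (f_row n \<tau>) * (lp_norm 1 t)\<^sup>2 / (\<gamma> ^ 3 * \<epsilon>\<^sup>2))
            * ln (2 + real n + 1 / \<gamma> + 1 / \<epsilon>) ^ 3)"
      unfolding f_def[symmetric] t1_def[symmetric] \<Lambda>_def[symmetric] X1_def[symmetric] X2_def[symmetric]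
      using loss prob time1 le1 le2 by (blast intro: order_trans)
  qed
qed

end
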